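(* Let $F$ be a field, let $q,n\in\mathbb{N}$ with $q>1$ and $n$ even, and let $e\in\mathbb{N}$ be a proper divisor of $q^n-1$ (that is, $e\mid q^n-1$ and $e\neq q^n-1$) and a multiple of $q^{n/2}-1$. Put $z=\frac{q^n-1}{e}$. Then $s_q(ke)=n\frac{q-1}{2}$ for $k=1,\dots,z-1$; in particular, $m(q,e)=n\frac{q-1}{2}$ and $$\mathrm{LL}(A(q,n,e))=3=n\frac{q-1}{m(q,e)}+1.$$
   Context: $\mathbb{N}$ denotes the set of positive integers, $\mathbb{N}_0=\mathbb{N}\cup\{0\}$. For $x\in\mathbb{N}_0$, $s_q(x)$ denotes the $q$-adic digit sum of $x$, i.e. $s_q(x)=x_0+x_1+\dots+x_r$ if $x=x_0+x_1q+\dots+x_rq^r$ with digits $0\le x_i<q$. For $q,e\in\mathbb{N}$ with $\gcd(q,e)=1$, $m(q,e)$ is the smallest positive integer $t$ such that there exist $i_1,\dots,i_t\in\mathbb{N}_0$ (repetitions allowed) with $e\mid q^{i_1}+\dots+q^{i_t}$. For a field $F$ and $q,n,e\in\mathbb{N}$ with $q>1$ and $e\mid q^n-1$, let $I=(X_1^q,\dots,X_n^q)$ in the polynomial algebra $F[X_1,\dots,X_n]$ and $x_j=X_j+I$. Then $A(q,n,e)$ is the unital $F$-subalgebra of $F[x_1,\dots,x_n]=F[X_1,\dots,X_n]/I$ generated by all monomials $x_1^{i_1}\cdots x_n^{i_n}$ with $i_1+qi_2+\dots+q^{n-1}i_n\equiv 0\pmod e$. For a finite-dimensional algebra $A$ with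 Jacobson radical $\mathrm{J}(A)$, the Loewy length $\mathrm{LL}(A)$ is the smallest $l\in\mathbb{N}_0$ with $\mathrm{J}(A)^l=0$. *)

theory Defs
  imports
    "HOL-Library.Poly_Mapping"
    "HOL-Number_Theory.Cong"
    "HOL-Algebra.Generated_Rings"
    "HOL-Algebra.Ideal_Product"
    "HOL-Algebra.QuotRing"
    "HOL-Algebra.FiniteProduct"
begin

(* The i-th base-q digit of x is (x div q ^ i) mod q.  For q > 1 it vanishes
   whenever i > x, because q ^ i > i > x; so summing over i \<le> x gives all digits. *)
definition digit_sum :: "nat \<Rightarrow> nat \<Rightarrow> nat" where
  "digit_sum q x = (\<Sum>i\<le>x. (x div q ^ i) mod q)"

(* m(q,e).  Only meaningful for e > 0 coprime to q, when such a t exists. *)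
definition min_power_sum :: "nat \<Rightarrow> nat \<Rightarrow> nat" where
  "min_power_sum q e = (LEAST t. 0 < t \<and> (\<exists>i :: nat \<Rightarrow> nat. e dvd (\<Sum>j=1..t. q ^ i j)))"

(* F[X_1,...,X_n]: an exponent vector is a finitely supported map nat \<Rightarrow>\<^sub>0 nat, and
   (nat \<Rightarrow>\<^sub>0 nat) \<Rightarrow>\<^sub>0 'f with the convolution product is the polynomial ring over the
   field 'f in the variables X_j (j :: nat); only X_1, ..., X_n may occur. *)
definition mpoly_ring :: "nat \<Rightarrow> ((nat \<Rightarrow>\<^sub>0 nat) \<Rightarrow>\<^sub>0 'f::field) ring" where
  "mpoly_ring n =
     \<lparr>carrier = {p. \<forall>m\<in>Poly_Mapping.keys p. Poly_Mapping.keys m \<subseteq> {1..n}},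
      mult = (*), one = 1, zero = 0, add = (+)\<rparr>"

definition mpoly_const :: "'f \<Rightarrow> (nat \<Rightarrow>\<^sub>0 nat) \<Rightarrow>\<^sub>0 'f::field" where
  "mpoly_const c = Poly_Mapping.single 0 c"

definition mpoly_var :: "nat \<Rightarrow> (nat \<Rightarrow>\<^sub>0 nat) \<Rightarrow>\<^sub>0 'f::field" where
  "mpoly_var j = Poly_Mapping.single (Poly_Mapping.single j 1) 1"

definition trunc_ideal :: "nat \<Rightarrow> nat \<Rightarrow> ((nat \<Rightarrow>\<^sub>0 nat) \<Rightarrow>\<^sub>0 'f::field) set" where
  "trunc_ideal q n = Idl\<^bsub>mpoly_ring n\<^esub> {mpoly_var j ^ q | j. j \<in> {1..n}}"

definition trunc_ring :: "nat \<Rightarrow> nat \<Rightarrow> ((nat \<Rightarrow>\<^sub>0 nat) \<Rightarrow>\<^sub>0 'f::field) set ring" where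
  "trunc_ring q n = mpoly_ring n Quot trunc_ideal q n"

definition trunc_class ::
  "nat \<Rightarrow> nat \<Rightarrow> ((nat \<Rightarrow>\<^sub>0 nat) \<Rightarrow>\<^sub>0 'f::field) \<Rightarrow> ((nat \<Rightarrow>\<^sub>0 nat) \<Rightarrow>\<^sub>0 'f) set" where
  "trunc_class q n p = trunc_ideal q n +>\<^bsub>mpoly_ring n\<^esub> p"

(* The monomial x_1^(i 1) ... x_n^(i n), computed in the quotient ring. *)
definition trunc_monom ::
  "nat \<Rightarrow> nat \<Rightarrow> (nat \<Rightarrow> nat) \<Rightarrow> ((nat \<Rightarrow>\<^sub>0 nat) \<Rightarrow>\<^sub>0 'f::field) set" where
  "trunc_monom q n i =
     (\<Otimes>\<^bsub>trunc_ring q n\<^esub> j\<in>{1..n}. trunc_class q n (mpoly_var j) [^]\<^bsub>trunc_ring q n\<^esub> i j)"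

(* A(q,n,e).  The unital F-subalgebra generated by a set S is the subring (with 1)
   generated by S together with the image of F. *)
definition alg_A :: "nat \<Rightarrow> nat \<Rightarrow> nat \<Rightarrow> ((nat \<Rightarrow>\<^sub>0 nat) \<Rightarrow>\<^sub>0 'f::field) set ring" where
  "alg_A q n e = (trunc_ring q n)
     \<lparr>carrier := generate_ring (trunc_ring q n)
        ({trunc_class q n (mpoly_const c) | c. True} \<union>
         {trunc_monom q n i | i. [(\<Sum>j=1..n. q ^ (j - 1) * i j) = 0] (mod e)})\<rparr>"

(* For commutative R, where left, right and two-sided ideals coincide. *)
definition jacobson_radical :: "('a, 'b) ring_scheme \<Rightarrow> 'a set" where
  "jacobson_radical R = carrier R \<inter> \<Inter> {M. maximalideal M R}"

(* Powers are taken in the monoid of ideals, so the 0-th power is carrier R. *)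
definition loewy_length :: "('a, 'b) ring_scheme \<Rightarrow> nat" where
  "loewy_length R =
     (LEAST l::nat. jacobson_radical R [^]\<^bsub>ideals_set R\<^esub> l = {\<zero>\<^bsub>R\<^esub>})"

end

theory Submission
  imports Defs
begin

text \<open>
  Let \<open>h = n / 2\<close>. For \<open>1 \<le> a \<le> q ^ h\<close> the base-\<open>q\<close> expansion of \<open>(q ^ h - 1) * a\<close> consists of two
  complementary blocks of \<open>h\<close> digits, so its digit sum is \<open>h * (q - 1)\<close>. Conversely every positive
  multiple of \<open>q ^ h - 1\<close> has digit sum at least \<open>h * (q - 1)\<close>, which by subadditivity of the digit
  sum bounds the number of summands in \<open>m(q,e)\<close> as well as the degree of every nonconstant monomial
  in \<open>A(q,n,e)\<close>. The algebra is local, and its radical consists of the classes of polynomials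
  without constant term. A product of three nonconstant monomials has degree larger than
  \<open>n * (q - 1)\<close> and vanishes, whereas the monomials given by the digits of \<open>e\<close> and of
  \<open>q ^ n - 1 - e\<close> multiply to the nonzero monomial with all exponents \<open>q - 1\<close>.
\<close>

section \<open>Digit sums\<close>

lemma less_power_self_nat:
  fixes q x :: nat
  assumes "q > 1"
  shows "x < q ^ x"
proof -
  have "x < 2 ^ x"
    by (rule less_exp)
  also have "\<dots> \<le> q ^ x"
    using assms by (intro power_mono) auto
  finally show ?thesis .
qed

text \<open>A digit at position \<open>i\<close> vanishes as soon as \<open>x < q ^ i\<close>. This
  covers all \<open>i > x\<close> and all \<open>i \<ge> N\<close>, so both sums can be compared
  with the sum up to \<open>max N (Suc x)\<close>.\<close>

lemma digit_sum_eq_sum_lessThan: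
  assumes "q > 1" "x < q ^ N"
  shows "digit_sum q x = (\<Sum>i<N. (x div q ^ i) mod q)"
proof -
  have zero: "(x div q ^ i) mod q = 0" if "x < q ^ i" for i
    using that by simp
  have large: "x < q ^ i" if "x < i" for i
    using that less_power_self_nat[OF assms(1), of i] by (rule less_trans)
  have beyond: "x < q ^ i" if "N \<le> i" for i
    using assms(2) power_increasing[OF that, of q] assms(1) by linarith
  have "digit_sum q x = (\<Sum>i<max N (Suc x). (x div q ^ i) mod q)"
    unfolding digit_sum_def
    by (rule sum.mono_neutral_left) (use zero large in \<open>auto simp: not_le\<close>)
  also have "\<dots> = (\<Sum>i<N. (x div q ^ i) mod q)"
    by (rule sum.mono_neutral_right) (use zero beyond in \<open>auto simp: not_less\<close>)
  finally show ?thesis .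
qed

text \<open>The summand at index 0 is \<open>r\<close>, and dividing \<open>r + q * u\<close> by
  \<open>q ^ Suc i\<close> gives \<open>u div q ^ i\<close>. Apart from the value at 0, all later
  facts on digit sums rest on this recursion instead of the defining sum.\<close>

lemma digit_sum_add_mult:
  assumes "q > 1" "r < q"
  shows "digit_sum q (r + q * u) = r + digit_sum q u"
proof -
  have u: "u < q ^ u"
    using assms(1) by (rule less_power_self_nat)
  \<comment> \<open>From \<open>u < q ^ u\<close> follows \<open>Suc u \<le> q ^ u\<close>, so
    \<open>Suc u\<close> digits suffice for \<open>r + q * u\<close>.\<close>
  have "r + q * u < q + q * u"
    using assms(2) by simp
  also have "\<dots> = q * Suc u"
    by simp
  also have "\<dots> \<le> q * q ^ u"
    using u by (intro mult_le_mono) auto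
  finally have less: "r + q * u < q ^ Suc u"
    by simp
  have "digit_sum q (r + q * u) = (\<Sum>i<Suc u. ((r + q * u) div q ^ i) mod q)"
    using assms(1) less by (rule digit_sum_eq_sum_lessThan)
  also have "\<dots> = r + (\<Sum>i<u. (u div q ^ i) mod q)"
    using assms by (simp add: sum.lessThan_Suc_shift div_mult2_eq del: sum.lessThan_Suc)
  finally show ?thesis
    using digit_sum_eq_sum_lessThan[OF assms(1) u] by simp
qed

lemma digit_sum_0 [simp]: "digit_sum q 0 = 0"
  by (simp add: digit_sum_def)

lemma digit_sum_rec:
  assumes "q > 1"
  shows "digit_sum q x = x mod q + digit_sum q (x div q)"
  using digit_sum_add_mult[OF assms, of "x mod q" "x div q"] assms by simp

lemma digit_sum_power_mult: "q > 1 \<Longrightarrow> digit_sum q (q ^ i * x) = digit_sum q x"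
proof (induction i)
  case (Suc i)
  then show ?case
    using digit_sum_add_mult[of q 0 "q ^ i * x"] by (simp add: mult.assoc)
qed simp

text \<open>Either the last digit grows by one, or it drops from \<open>q - 1\<close> to 0 and the
  increment is carried to the quotient, where induction applies.\<close>

lemma digit_sum_Suc_le:
  assumes "q > 1"
  shows "digit_sum q (Suc x) \<le> Suc (digit_sum q x)"
proof (induction x rule: less_induct)
  case (less x)
  show ?case
  proof (cases "Suc (x mod q) = q")
    case True
    have "Suc x = 0 + q * Suc (x div q)"
      using True mult_div_mod_eq[of q x] by (simp only: mult_Suc_right)
    then have "digit_sum q (Suc x) = digit_sum q (Suc (x div q))"
      using digit_sum_add_mult[of q 0 "Suc (x div q)"] assms by simp
    also have "\<dots> \<le> Suc (digit_sum q (x div q))"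
    proof (rule less)
      have "x \<noteq> 0"
        using True assms by (intro notI) simp
      then show "x div q < x"
        using assms by simp
    qed
    also have "\<dots> \<le> Suc (digit_sum q x)"
      using digit_sum_rec[OF assms, of x] by simp
    finally show ?thesis .
  next
    case False
    have "Suc x = Suc (x mod q) + q * (x div q)"
      by simp
    moreover have "Suc (x mod q) < q"
      using False assms by (metis Suc_lessI less_trans mod_less_divisor zero_less_one)
    ultimately have "digit_sum q (Suc x) = Suc (x mod q) + digit_sum q (x div q)"
      using digit_sum_add_mult[OF assms] by metis
    then show ?thesis
      using digit_sum_rec[OF assms, of x] by simp
  qed
qed

text \<open>In column addition every carry trades \<open>q\<close> units of one column for a single
  unit of the next, so carries can only lower the digit sum.\<close>

lemma digit_sum_add_le:
  assumes "q > 1"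
  shows "digit_sum q (x + y) \<le> digit_sum q x + digit_sum q y"
proof (induction "x + y" arbitrary: x y rule: less_induct)
  case less
  define u v r s where defs: "u = x div q" "v = y div q" "r = x mod q" "s = y mod q"
  have xy: "x = r + q * u" "y = s + q * v" and rs: "r < q" "s < q"
    using assms by (simp_all add: defs)
  have ds: "digit_sum q x = r + digit_sum q u" "digit_sum q y = s + digit_sum q v"
    using digit_sum_add_mult[OF assms] rs by (simp_all add: xy)
  show ?case
  proof (cases "x = 0 \<or> y = 0")
    case False
    then have uv: "u < x" "v < y"
      using assms by (simp_all add: defs)
    show ?thesis
    proof (cases "r + s < q")
      case True
      have "x + y = (r + s) + q * (u + v)"
        by (simp add: xy algebra_simps)
      then have "digit_sum q (x + y) = r + s + digit_sum q (u + v)"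
        using digit_sum_add_mult[OF assms True] by simp
      then show ?thesis
        using less[of u v] uv ds by simp
    next
      \<comment> \<open>The carry is absorbed into \<open>Suc v\<close>. It raises the digit sum by
        at most one, while the last column loses \<open>q\<close>.\<close>
      case False
      then have "x + y = (r + s - q) + q * (u + Suc v)" "r + s - q < q"
        using rs by (simp_all add: xy algebra_simps)
      then have "digit_sum q (x + y) = (r + s - q) + digit_sum q (u + Suc v)"
        using digit_sum_add_mult[OF assms] by metis
      \<comment> \<open>The strict bounds \<open>u < x\<close> and \<open>v < y\<close> leave room
        for the carry: \<open>u + Suc v < x + y\<close>.\<close>
      moreover have "digit_sum q (u + Suc v) \<le> digit_sum q u + digit_sum q (Suc v)"
        using uv by (intro less) simp
      ultimately show ?thesis
        using digit_sum_Suc_le[OF assms, of v] ds False assms by linarith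
    qed
  qed auto
qed

lemma digit_sum_le_self: "q > 1 \<Longrightarrow> digit_sum q x \<le> x"
proof (induction x)
  case (Suc x)
  then show ?case
    using digit_sum_Suc_le[of q x] by simp
qed simp

text \<open>Subadditivity reduces this to single summands, where the factor \<open>q ^ a j\<close>
  only shifts digits. With coefficients 1 it bounds the number of powers in m(q,e); with the
  exponents of a monomial as coefficients it bounds the degree from below.\<close>

lemma digit_sum_weighted_sum_le:
  assumes "q > 1" "finite S"
  shows "digit_sum q (\<Sum>j\<in>S. q ^ a j * c j) \<le> (\<Sum>j\<in>S. c j)"
  using assms(2)
proof (induction S rule: finite_induct)
  case (insert j S)
  have "digit_sum q (q ^ a j * c j) \<le> c j"
    using assms(1) by (simp add: digit_sum_power_mult digit_sum_le_self)
  then show ?case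
    using insert digit_sum_add_le[OF assms(1), of "q ^ a j * c j" "\<Sum>j\<in>S. q ^ a j * c j"]
    by simp
qed simp

section \<open>Digit blocks of length \<open>h\<close> and multiples of
  \<open>q ^ h - 1\<close>\<close>

lemma digit_sum_split:
  assumes "q > 1"
  shows "a < q ^ h \<Longrightarrow> digit_sum q (a + q ^ h * b) = digit_sum q a + digit_sum q b"
proof (induction h arbitrary: a)
  case (Suc h)
  have less: "a div q < q ^ h"
    using Suc.prems by (simp add: less_mult_imp_div_less mult.commute)
  have "a + q ^ Suc h * b = a mod q + q * (a div q + q ^ h * b)"
    by (simp add: algebra_simps)
  then have "digit_sum q (a + q ^ Suc h * b) = a mod q + digit_sum q (a div q + q ^ h * b)"
    using digit_sum_add_mult[OF assms, of "a mod q"] assms by simp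
  then show ?case
    using Suc.IH[OF less] digit_sum_rec[OF assms, of a] by simp
qed simp

text \<open>All \<open>h\<close> digits of \<open>q ^ h - 1\<close> equal \<open>q - 1\<close>, so
  \<open>a\<close> is subtracted digit by digit without borrowing, and each pair of corresponding
  digits adds up to \<open>q - 1\<close>.\<close>

lemma digit_sum_complement:
  assumes "q > 1"
  shows "a < q ^ h \<Longrightarrow> digit_sum q a + digit_sum q (q ^ h - 1 - a) = h * (q - 1)"
proof (induction h arbitrary: a)
  case (Suc h)
  have less: "a div q < q ^ h"
    using Suc.prems by (simp add: less_mult_imp_div_less mult.commute)
  have rless: "a mod q < q"
    using assms by simp
  have "q ^ Suc h - 1 - a = (q - 1 - a mod q) + q * (q ^ h - 1 - a div q)"
  proof -
    \<comment> \<open>\<open>c\<close> and \<open>d\<close> are the complements of the quotient and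
      of the last digit. Naming them turns the truncated differences into sums.\<close>
    obtain c where c: "q ^ h = Suc (c + a div q)"
      using less by (metis add.commute less_iff_Suc_add)
    obtain d where d: "q = Suc (d + a mod q)"
      using rless by (metis add.commute less_iff_Suc_add)
    have "d + q * c + a + 1 = q + q * c + q * (a div q)"
      using d mult_div_mod_eq[of q a] by linarith
    also have "\<dots> = q ^ Suc h"
      by (simp add: c algebra_simps)
    finally have "q ^ Suc h - 1 - a = d + q * c"
      by linarith
    moreover have "q - 1 - a mod q = d"
      using d by linarith
    ultimately show ?thesis
      by (simp add: c)
  qed
  moreover have "q - 1 - a mod q < q"
    using assms by simp
  ultimately have "digit_sum q (q ^ Suc h - 1 - a)
      = (q - 1 - a mod q) + digit_sum q (q ^ h - 1 - a div q)"
    using digit_sum_add_mult[OF assms] by metis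
  then show ?case
    using Suc.IH[OF less] digit_sum_rec[OF assms, of a] rless by simp
qed simp

text \<open>The base-\<open>q\<close> digits of \<open>(q ^ h - 1) * a = (a - 1) * q ^ h + (q ^ h - a)\<close> form two
  complementary blocks of length \<open>h\<close>.\<close>

lemma digit_sum_mult_power_minus_one:
  assumes "q > 1" "0 < a" "a \<le> q ^ h"
  shows "digit_sum q ((q ^ h - 1) * a) = h * (q - 1)"
proof -
  obtain b where b: "a = Suc b"
    using assms(2) gr0_implies_Suc by blast
  \<comment> \<open>With \<open>a = Suc b\<close> the low block is the digitwise complement of the
    high block \<open>b\<close>.\<close>
  have "(q ^ h - 1) * a = (q ^ h - 1 - b) + q ^ h * b"
    using assms(3) by (simp add: b algebra_simps diff_mult_distrib)
  then show ?thesis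
    using digit_sum_split[OF assms(1), of "q ^ h - 1 - b" h b] digit_sum_complement[OF assms(1), of b h]
      assms(3) by (simp add: b)
qed

text \<open>Adding up the blocks of \<open>h\<close> digits preserves the residue modulo \<open>q ^ h - 1\<close> and does not
  increase the digit sum.\<close>

lemma digit_sum_ge_of_power_minus_one_dvd:
  assumes "q > 1" "h > 0"
  shows "(q ^ h - 1) dvd x \<Longrightarrow> x > 0 \<Longrightarrow> h * (q - 1) \<le> digit_sum q x"
proof (induction x rule: less_induct)
  case (less x)
  have qh: "q ^ h > 1"
    using assms by (rule one_less_power)
  define u v where uv: "u = x mod q ^ h" "v = x div q ^ h"
  have x: "x = u + q ^ h * v" and u: "u < q ^ h"
    using qh by (simp_all add: uv less_imp_le mod_less_divisor[OF less_trans[OF zero_less_one qh]])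
  show ?case
  proof (cases "v = 0")
    case True
    \<comment> \<open>Without a high block, \<open>x\<close> can only be \<open>q ^ h - 1\<close>
      itself.\<close>
    then have "x \<le> q ^ h - 1"
      using x u by simp
    then have "x = (q ^ h - 1) * 1"
      using less.prems by (simp add: dvd_imp_le le_antisym)
    then show ?thesis
      using digit_sum_mult_power_minus_one[OF assms(1), of 1 h] qh by simp
  next
    case False
    have "x = (u + v) + (q ^ h - 1) * v"
      using qh by (simp add: x algebra_simps diff_mult_distrib)
    moreover from this have "(q ^ h - 1) dvd u + v"
      using less.prems(1) by (metis dvd_add_left_iff dvd_triv_left)
    \<comment> \<open>This difference between \<open>x\<close> and \<open>u + v\<close> makes
      \<open>u + v\<close> strictly smaller, as the induction requires; \<open>v \<noteq> 0\<close>
      keeps \<open>u + v\<close> positive.\<close>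
    moreover have "(q ^ h - 1) * v > 0"
      using qh False by simp
    ultimately have "h * (q - 1) \<le> digit_sum q (u + v)"
      using False by (intro less.IH) linarith+
    also have "\<dots> \<le> digit_sum q u + digit_sum q v"
      by (rule digit_sum_add_le[OF assms(1)])
    also have "\<dots> = digit_sum q x"
      using digit_sum_split[OF assms(1) u] x by simp
    finally show ?thesis .
  qed
qed

section \<open>Sums of powers of \<open>q\<close> and the value of m(q,e)\<close>

lemma ex_power_sum_digit_sum:
  assumes "q > 1"
  shows "\<exists>i :: nat \<Rightarrow> nat. x = (\<Sum>j::nat=1..digit_sum q x. q ^ i j)"
proof (induction x rule: less_induct)
  case (less x)
  show ?case
  proof (cases "x = 0")
    case False
    then obtain i where i: "x div q = (\<Sum>j=1..digit_sum q (x div q). q ^ i j)"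
      using less[of "x div q"] assms by auto
    define s where "s = digit_sum q (x div q)"
    \<comment> \<open>The powers representing \<open>x div q\<close> are shifted by one exponent,
      and the last digit is appended as \<open>x mod q\<close> copies of
      \<open>q ^ 0\<close>.\<close>
    define i' where "i' j = (if j \<le> s then Suc (i j) else 0)" for j
    have "(\<Sum>j=1..s + x mod q. q ^ i' j) = (\<Sum>j=1..s. q ^ i' j) + (\<Sum>j=s+1..s + x mod q. q ^ i' j)"
      by (rule sum.ub_add_nat) simp
    also have "(\<Sum>j=1..s. q ^ i' j) = q * (x div q)"
      by (subst i) (simp add: i'_def s_def sum_distrib_left)
    also have "(\<Sum>j=s+1..s + x mod q. q ^ i' j) = x mod q"
      by (simp add: i'_def)
    finally have "x = (\<Sum>j=1..digit_sum q x. q ^ i' j)"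
      using digit_sum_rec[OF assms, of x] by (simp add: s_def add.commute)
    then show ?thesis
      by (rule exI[of _ i'])
  qed simp
qed

lemma sum_digits_mult_power: "(\<Sum>i<N. q ^ i * (x div q ^ i mod q)) = x mod q ^ N" for q x :: nat
proof (induction N)
  case (Suc N)
  then show ?case
    using mod_mult2_eq[of x "q ^ N" q] by (simp add: mult.commute add.commute)
qed simp

text \<open>\<open>e\<close> itself is a sum of \<open>digit_sum q e\<close> powers of
  \<open>q\<close>, which gives the upper bound. Conversely, a sum of \<open>t\<close> powers
  divisible by \<open>e\<close> is a positive multiple of \<open>q ^ h - 1\<close>, so its digit sum
  is at least \<open>h * (q - 1)\<close> and at most \<open>t\<close>.\<close>

lemma min_power_sum_eq:
  assumes "q > 1" "h > 0" "(q ^ h - 1) dvd e" "digit_sum q e = h * (q - 1)"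
  shows "min_power_sum q e = h * (q - 1)"
  unfolding min_power_sum_def
proof (rule Least_equality)
  obtain i :: "nat \<Rightarrow> nat" where "e = (\<Sum>j=1..h * (q - 1). q ^ i j)"
    using ex_power_sum_digit_sum[OF assms(1), of e] assms(4) by auto
  then show "0 < h * (q - 1) \<and> (\<exists>i. e dvd (\<Sum>j=1..h * (q - 1). q ^ i j))"
    using assms(1,2) by (metis dvd_refl nat_0_less_mult_iff zero_less_diff)
next
  fix t :: nat assume "0 < t \<and> (\<exists>i. e dvd (\<Sum>j=1..t. q ^ i j))"
  then obtain i :: "nat \<Rightarrow> nat" where t: "0 < t" and i: "e dvd (\<Sum>j=1..t. q ^ i j)"
    by blast
  have "h * (q - 1) \<le> digit_sum q (\<Sum>j=1..t. q ^ i j)"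
  proof (rule digit_sum_ge_of_power_minus_one_dvd[OF assms(1,2)])
    show "(q ^ h - 1) dvd (\<Sum>j=1..t. q ^ i j)"
      using assms(3) i by (rule dvd_trans)
    show "0 < (\<Sum>j=1..t. q ^ i j)"
      using t assms(1) by (intro sum_pos) auto
  qed
  also have "\<dots> \<le> t"
    using digit_sum_weighted_sum_le[OF assms(1), of "{1..t}" i "\<lambda>_. 1"] by simp
  finally show "h * (q - 1) \<le> t" .
qed

section \<open>Commutative rings with a nil maximal ideal\<close>

text \<open>Inverses modulo \<open>M\<close> make \<open>M\<close> maximal. Nilpotent elements lie
  in every prime ideal, hence \<open>M\<close> lies in every maximal ideal, and the intersection of
  all of them is \<open>M\<close>.\<close>

lemma (in cring) jacobson_radical_eqI:
  assumes M: "ideal M R" "\<one> \<notin> M"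
    and nil: "\<And>x. x \<in> M \<Longrightarrow> \<exists>k::nat. x [^] k = \<zero>"
    and unit: "\<And>x. x \<in> carrier R \<Longrightarrow> x \<notin> M \<Longrightarrow> \<exists>u\<in>carrier R. u \<otimes> x \<ominus> \<one> \<in> M"
  shows "jacobson_radical R = M"
proof -
  have "maximalideal M R"
  proof (rule maximalidealI[OF M(1)])
    show "carrier R \<noteq> M"
      using M(2) by auto
  next
    fix J assume J: "ideal J R" "M \<subseteq> J" "J \<subseteq> carrier R"
    interpret J: ideal J R by (fact J(1))
    show "J = M \<or> J = carrier R"
    proof (rule disjCI)
      assume "J \<noteq> carrier R"
      have "x \<in> M" if "x \<in> J" for x
      proof (rule ccontr)
        assume "x \<notin> M"
        moreover have x: "x \<in> carrier R"
          using that J(3) by blast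
        ultimately obtain u where u: "u \<in> carrier R" "u \<otimes> x \<ominus> \<one> \<in> J"
          using unit J(2) by blast
        have "u \<otimes> x \<in> J"
          using that u(1) by (rule J.I_l_closed)
        \<comment> \<open>Both terms of this difference lie in \<open>J\<close>, and the difference
          is the unit element.\<close>
        then have "u \<otimes> x \<ominus> (u \<otimes> x \<ominus> \<one>) \<in> J"
          unfolding a_minus_def[of R "u \<otimes> x" "u \<otimes> x \<ominus> \<one>"]
          using u(2) by (intro J.a_closed J.a_inv_closed)
        moreover have "u \<otimes> x \<ominus> (u \<otimes> x \<ominus> \<one>) = \<one>"
          using u(1) x by (simp add: a_minus_def minus_add r_neg2)
        ultimately show False
          using J.one_imp_carrier \<open>J \<noteq> carrier R\<close> by simp
      qed
      then show "J = M"
        using J(2) by blast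
    qed
  qed
  moreover have "M \<subseteq> N" if "maximalideal N R" for N
  proof
    fix x assume x: "x \<in> M"
    interpret N: primeideal N R
      using that by (rule maximalideal_prime)
    have carr: "x \<in> carrier R"
      using M(1) x by (rule ideal.Icarr)
    \<comment> \<open>Primality strips off one factor at a time; exponent 0 is impossible because
      \<open>N\<close> is proper.\<close>
    have root: "x \<in> N" if "x [^] k \<in> N" for k :: nat
      using that
    proof (induction k)
      case 0
      then show ?case
        using N.one_imp_carrier N.I_notcarr by simp
    next
      case (Suc k)
      then show ?case
        using N.I_prime[of "x [^] k" x] carr by auto
    qed
    obtain k :: nat where "x [^] k = \<zero>"
      using nil[OF x] by auto
    then show "x \<in> N"
      using root[of k] N.zero_closed by simp
  qed
  moreover have "M \<subseteq> carrier R"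
    using ideal.Icarr[OF M(1)] by blast
  ultimately show ?thesis
    unfolding jacobson_radical_def by auto
qed

text \<open>The product \<open>x \<otimes> y\<close> shows that the square of \<open>M\<close> is
  nonzero; it also forces \<open>x \<noteq> \<zero>\<close>, which rules out the exponents 0 and
  1.\<close>

lemma (in cring) loewy_length_eq_3I:
  assumes M: "ideal M R" "jacobson_radical R = M"
    and cube: "ideal_prod R (ideal_prod R M M) M = {\<zero>}"
    and xy: "x \<in> M" "y \<in> M" "x \<otimes> y \<noteq> \<zero>"
  shows "loewy_length R = 3"
proof -
  have pow_Suc: "M [^]\<^bsub>ideals_set R\<^esub> Suc l = ideal_prod R (M [^]\<^bsub>ideals_set R\<^esub> l) M" for l
    by (simp add: ideals_set_def)
  have pow0: "M [^]\<^bsub>ideals_set R\<^esub> (0::nat) = carrier R"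
    by (simp add: ideals_set_def)
  \<comment> \<open>By recursion the first power is the product of \<open>carrier R\<close> and
    \<open>M\<close>, in the order opposite to \<open>ideal_prod_one\<close>.\<close>
  have pow1: "M [^]\<^bsub>ideals_set R\<^esub> (1::nat) = M"
    unfolding One_nat_def pow_Suc pow0 ideal_prod_commute[OF oneideal M(1)]
    by (rule ideal_prod_one[OF M(1)])
  have pow2: "M [^]\<^bsub>ideals_set R\<^esub> (2::nat) = ideal_prod R M M"
    using pow_Suc[of 1] unfolding pow1 Suc_1 .
  have pow3: "M [^]\<^bsub>ideals_set R\<^esub> (3::nat) = {\<zero>}"
    using pow_Suc[of 2] cube unfolding pow2 by (simp add: numeral_3_eq_3 numeral_2_eq_2)
  have carr: "x \<in> carrier R" "y \<in> carrier R"
    using xy ideal.Icarr[OF M(1)] by blast+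
  have x: "x \<noteq> \<zero>"
    using xy(3) carr by auto
  have ne: "M [^]\<^bsub>ideals_set R\<^esub> l \<noteq> {\<zero>}" if l_less: "l < 3" for l :: nat
  proof -
    consider "l = 0" | "l = 1" | "l = 2"
      using l_less by linarith
    then show ?thesis
    proof cases
      case 1
      then show ?thesis
        using pow0 carr x by auto
    next
      case 2
      then show ?thesis
        using pow1 xy(1) x by auto
    next
      case 3
      then show ?thesis
        using pow2 ideal_prod.prod[OF xy(1,2), of R] xy(3) by auto
    qed
  qed
  show ?thesis
    unfolding loewy_length_def M(2)
  proof (rule Least_equality)
    show "M [^]\<^bsub>ideals_set R\<^esub> (3::nat) = {\<zero>}"
      by (rule pow3)
    show "3 \<le> l" if "M [^]\<^bsub>ideals_set R\<^esub> l = {\<zero>}" for l :: nat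
      using ne that not_less by blast
  qed
qed

section \<open>Polynomials with prescribed monomials\<close>

text \<open>The span of the monomials with exponents in \<open>S\<close>. The polynomial ring and
  the truncation ideal are of this form, and the algebra and its radical are described by
  representatives in such sets, so that membership becomes a question about exponents.\<close>

definition polys_on :: "'m set \<Rightarrow> ('m \<Rightarrow>\<^sub>0 'a::zero) set" where
  "polys_on S = {p. Poly_Mapping.keys p \<subseteq> S}"

lemma polys_on_zero [simp]: "0 \<in> polys_on S"
  by (simp add: polys_on_def)

lemma polys_on_mono: "S \<subseteq> T \<Longrightarrow> polys_on S \<subseteq> polys_on T"
  by (auto simp: polys_on_def)

lemma polys_on_single [simp]: "m \<in> S \<Longrightarrow> Poly_Mapping.single m c \<in> polys_on S"
  by (simp add: polys_on_def)

lemma polys_on_one: "0 \<in> S \<Longrightarrow> 1 \<in> polys_on S"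
  by (simp add: polys_on_def)

lemma polys_on_add: "p \<in> polys_on S \<Longrightarrow> r \<in> polys_on S \<Longrightarrow> p + r \<in> polys_on S"
  unfolding polys_on_def using keys_add[of p r] by blast

lemma polys_on_uminus:
  fixes p :: "'m \<Rightarrow>\<^sub>0 'a::ab_group_add"
  shows "p \<in> polys_on S \<Longrightarrow> - p \<in> polys_on S"
  by (auto simp: polys_on_def in_keys_iff subset_iff)

lemma polys_on_mult:
  assumes "p \<in> polys_on S" "r \<in> polys_on T" "\<And>a b. a \<in> S \<Longrightarrow> b \<in> T \<Longrightarrow> a + b \<in> U"
  shows "p * r \<in> polys_on U"
  using assms keys_mult[of p r] unfolding polys_on_def by blast

lemma poly_mapping_sum_single: "p = (\<Sum>m\<in>Poly_Mapping.keys p. Poly_Mapping.single m (Poly_Mapping.lookup p m))"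
  by (rule poly_mapping_eqI) (simp add: lookup_sum lookup_single when_def in_keys_iff)

lemma lookup_single_0_mult:
  fixes p :: "'m::monoid_add \<Rightarrow>\<^sub>0 'a::semiring_0"
  shows "Poly_Mapping.lookup (Poly_Mapping.single 0 c * p) m = c * Poly_Mapping.lookup p m"
  unfolding mult_map_scale_conv_mult[symmetric] by transfer (simp add: when_def)

section \<open>The polynomial ring and its truncation ideal as spans of monomials\<close>

type_synonym 'f mpoly = "(nat \<Rightarrow>\<^sub>0 nat) \<Rightarrow>\<^sub>0 'f"

definition exponents :: "nat \<Rightarrow> (nat \<Rightarrow>\<^sub>0 nat) set" where
  "exponents n = {m. Poly_Mapping.keys m \<subseteq> {1..n}}"

lemma exponents_zero [simp]: "0 \<in> exponents n"
  by (simp add: exponents_def)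

lemma exponents_add: "a \<in> exponents n \<Longrightarrow> b \<in> exponents n \<Longrightarrow> a + b \<in> exponents n"
  unfolding exponents_def using keys_add[of a b] by blast

lemma exponents_nonzeroE:
  assumes "m \<in> exponents n" "m \<noteq> 0"
  obtains j where "j \<in> {1..n}" "Poly_Mapping.lookup m j > 0"
proof -
  obtain j where "Poly_Mapping.lookup m j \<noteq> 0"
    using assms(2) by (metis poly_mapping_eqI lookup_zero)
  then show thesis
    using assms(1) that[of j] by (auto simp: exponents_def in_keys_iff subset_iff)
qed

lemma carrier_mpoly_ring: "carrier (mpoly_ring n) = polys_on (exponents n)"
  by (auto simp: mpoly_ring_def polys_on_def exponents_def)

lemma mpoly_ring_ops [simp]:
  "x \<otimes>\<^bsub>mpoly_ring n\<^esub> y = x * y" "x \<oplus>\<^bsub>mpoly_ring n\<^esub> y = x + y"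
  "\<one>\<^bsub>mpoly_ring n\<^esub> = 1" "\<zero>\<^bsub>mpoly_ring n\<^esub> = 0"
  by (simp_all add: mpoly_ring_def)

lemma cring_mpoly_ring: "cring (mpoly_ring n :: 'f::field mpoly ring)"
proof (rule cringI)
  show "abelian_group (mpoly_ring n :: 'f mpoly ring)"
  proof (rule abelian_groupI)
    fix x :: "'f mpoly" assume "x \<in> carrier (mpoly_ring n)"
    then show "\<exists>y\<in>carrier (mpoly_ring n). y \<oplus>\<^bsub>mpoly_ring n\<^esub> x = \<zero>\<^bsub>mpoly_ring n\<^esub>"
      by (intro bexI[of _ "- x"]) (auto simp: carrier_mpoly_ring polys_on_uminus)
  qed (auto simp: carrier_mpoly_ring polys_on_add add_ac)
  show "Group.comm_monoid (mpoly_ring n :: 'f mpoly ring)"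
    by (rule comm_monoidI)
      (auto simp: carrier_mpoly_ring polys_on_one mult_ac intro!: polys_on_mult exponents_add)
qed (auto simp: distrib_right)

lemma uminus_mpoly_ring:
  assumes "x \<in> carrier (mpoly_ring n)"
  shows "\<ominus>\<^bsub>mpoly_ring n\<^esub> x = - x"
proof -
  interpret cring "mpoly_ring n" by (rule cring_mpoly_ring)
  show ?thesis
    using assms by (intro minus_equality) (auto simp: carrier_mpoly_ring polys_on_uminus)
qed

lemma mpoly_var_power:
  "mpoly_var j ^ k = Poly_Mapping.single (Poly_Mapping.single j k) 1"
  by (induction k) (simp_all add: mpoly_var_def mult_single single_add[symmetric])

lemma mpoly_var_power_carrier:
  "j \<in> {1..n} \<Longrightarrow> mpoly_var j ^ k \<in> carrier (mpoly_ring n)"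
  by (simp add: mpoly_var_power carrier_mpoly_ring exponents_def)

lemma mpoly_ring_pow:
  "p [^]\<^bsub>mpoly_ring n\<^esub> (k::nat) = p ^ k"
  by (induction k) (simp_all add: mult.commute)

definition large_exponents :: "nat \<Rightarrow> nat \<Rightarrow> (nat \<Rightarrow>\<^sub>0 nat) set" where
  "large_exponents q n = {m \<in> exponents n. \<exists>j\<in>{1..n}. q \<le> Poly_Mapping.lookup m j}"

text \<open>Absorption holds because adding an exponent vector to a large one keeps a component that
  is at least \<open>q\<close>.\<close>

lemma ideal_polys_on_large_exponents:
  "ideal (polys_on (large_exponents q n)) (mpoly_ring n :: 'f::field mpoly ring)"
proof (rule idealI)
  interpret cring "mpoly_ring n :: 'f mpoly ring" by (rule cring_mpoly_ring)
  show "ring (mpoly_ring n :: 'f mpoly ring)"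
    by (rule ring_axioms)
  have sub: "polys_on (large_exponents q n) \<subseteq> carrier (mpoly_ring n :: 'f mpoly ring)"
    unfolding carrier_mpoly_ring by (rule polys_on_mono) (auto simp: large_exponents_def)
  show "subgroup (polys_on (large_exponents q n)) (add_monoid (mpoly_ring n :: 'f mpoly ring))"
  proof (rule add.subgroupI)
    fix a :: "'f mpoly" assume a: "a \<in> polys_on (large_exponents q n)"
    then show "\<ominus>\<^bsub>mpoly_ring n\<^esub> a \<in> polys_on (large_exponents q n)"
      using sub by (subst uminus_mpoly_ring) (auto intro: polys_on_uminus)
  next
    show "polys_on (large_exponents q n) \<noteq> ({} :: 'f mpoly set)"
      using polys_on_zero by blast
  qed (use sub in \<open>auto intro: polys_on_add\<close>)
  fix a x :: "'f mpoly"
  assume "a \<in> polys_on (large_exponents q n)" "x \<in> carrier (mpoly_ring n)"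
  then have "a * x \<in> polys_on (large_exponents q n)"
    unfolding carrier_mpoly_ring
    by (rule polys_on_mult) (auto simp: large_exponents_def exponents_add lookup_add intro: trans_le_add1)
  then show "x \<otimes>\<^bsub>mpoly_ring n\<^esub> a \<in> polys_on (large_exponents q n)"
    "a \<otimes>\<^bsub>mpoly_ring n\<^esub> x \<in> polys_on (large_exponents q n)"
    by (simp_all add: mult.commute)
qed

lemma ideal_trunc_ideal: "ideal (trunc_ideal q n) (mpoly_ring n :: 'f::field mpoly ring)"
proof -
  interpret cring "mpoly_ring n :: 'f mpoly ring" by (rule cring_mpoly_ring)
  show ?thesis
    unfolding trunc_ideal_def by (intro genideal_ideal) (auto intro: mpoly_var_power_carrier)
qed

text \<open>For an ideal generated by monomials, membership can be read off term by term: each term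
  must be divisible by some generator, here a power \<open>X_j ^ q\<close>. This makes the quotient
  computable on exponents.\<close>

lemma trunc_ideal_eq: "trunc_ideal q n = (polys_on (large_exponents q n) :: 'f::field mpoly set)"
proof
  interpret cring "mpoly_ring n :: 'f mpoly ring" by (rule cring_mpoly_ring)
  have "Poly_Mapping.single j q \<in> large_exponents q n" if "j \<in> {1..n}" for j
    using that by (auto simp: large_exponents_def exponents_def intro!: bexI[of _ j])
  then show "trunc_ideal q n \<subseteq> (polys_on (large_exponents q n) :: 'f mpoly set)"
    unfolding trunc_ideal_def
    by (intro genideal_minimal[OF ideal_polys_on_large_exponents])
      (auto simp: mpoly_var_power simp del: One_nat_def intro!: polys_on_single)
  interpret I: ideal "trunc_ideal q n" "mpoly_ring n :: 'f mpoly ring" by (rule ideal_trunc_ideal)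
  have gen: "mpoly_var j ^ q \<in> (trunc_ideal q n :: 'f mpoly set)" if "j \<in> {1..n}" for j
    unfolding trunc_ideal_def
    by (rule subsetD[OF genideal_self]) (use that in \<open>auto intro: mpoly_var_power_carrier\<close>)
  have monom: "Poly_Mapping.single m c \<in> (trunc_ideal q n :: 'f mpoly set)" if m_large: "m \<in> large_exponents q n" for m c
  proof -
    obtain j where j: "j \<in> {1..n}" "q \<le> Poly_Mapping.lookup m j" and m: "m \<in> exponents n"
      using m_large unfolding large_exponents_def by blast
    \<comment> \<open>The exponent of the cofactor of \<open>X_j ^ q\<close>; the truncated
      subtraction is exact since component \<open>j\<close> of \<open>m\<close> is at least
      \<open>q\<close>.\<close>
    let ?d = "m - Poly_Mapping.single j q"
    have "m = ?d + Poly_Mapping.single j q"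
      using j(2) by (intro poly_mapping_eqI) (auto simp: lookup_add lookup_minus lookup_single when_def)
    then have "Poly_Mapping.single m c = Poly_Mapping.single ?d c * mpoly_var j ^ q"
      by (metis mpoly_var_power mult_single mult.right_neutral)
    moreover have "?d \<in> exponents n"
      using m by (auto simp: exponents_def subset_iff in_keys_iff lookup_minus)
    ultimately show ?thesis
      using I.I_l_closed[OF gen[OF j(1)], of "Poly_Mapping.single ?d c"]
      by (simp add: carrier_mpoly_ring)
  qed
  have sum: "(\<Sum>m\<in>S. Poly_Mapping.single m (c m)) \<in> trunc_ideal q n"
    if "finite S" "S \<subseteq> large_exponents q n" for S and c :: "_ \<Rightarrow> 'f"
    using that
  proof (induction S rule: finite_induct)
    case empty
    then show ?case
      using I.zero_closed by simp
  next
    case (insert m S)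
    then show ?case
      using I.a_closed[OF monom[of m "c m"], of "\<Sum>m\<in>S. Poly_Mapping.single m (c m)"] by simp
  qed
  show "(polys_on (large_exponents q n) :: 'f mpoly set) \<subseteq> trunc_ideal q n"
  proof
    fix p :: "'f mpoly"
    assume "p \<in> polys_on (large_exponents q n)"
    then show "p \<in> trunc_ideal q n"
      using sum[of "Poly_Mapping.keys p" "Poly_Mapping.lookup p"] poly_mapping_sum_single[of p]
      by (simp add: polys_on_def)
  qed
qed

section \<open>The truncated polynomial ring\<close>

lemma trunc_class_hom:
  "ring_hom_cring (mpoly_ring n :: 'f::field mpoly ring) (trunc_ring q n) (trunc_class q n)"
proof -
  have eq: "trunc_class q n = (+>\<^bsub>mpoly_ring n :: 'f mpoly ring\<^esub>) (trunc_ideal q n)"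
    unfolding trunc_class_def by (rule refl)
  show ?thesis
    unfolding trunc_ring_def eq
    by (rule ideal.rcos_ring_hom_cring[OF ideal_trunc_ideal cring_mpoly_ring])
qed

lemma cring_trunc_ring: "cring (trunc_ring q n :: 'f::field mpoly set ring)"
  by (rule ring_hom_cring.axioms(2)[OF trunc_class_hom])

lemma trunc_class_carrier:
  "p \<in> polys_on (exponents n) \<Longrightarrow> trunc_class q n p \<in> carrier (trunc_ring q n)"
  by (rule ring_hom_closed[OF ring_hom_cring.homh[OF trunc_class_hom],
    unfolded carrier_mpoly_ring mpoly_ring_ops])

lemma trunc_class_mult:
  "p \<in> polys_on (exponents n) \<Longrightarrow> r \<in> polys_on (exponents n) \<Longrightarrow>
    trunc_class q n (p * r) = trunc_class q n p \<otimes>\<^bsub>trunc_ring q n\<^esub> trunc_class q n r"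
  by (rule ring_hom_mult[OF ring_hom_cring.homh[OF trunc_class_hom],
    unfolded carrier_mpoly_ring mpoly_ring_ops])

lemma trunc_class_add:
  "p \<in> polys_on (exponents n) \<Longrightarrow> r \<in> polys_on (exponents n) \<Longrightarrow>
    trunc_class q n (p + r) = trunc_class q n p \<oplus>\<^bsub>trunc_ring q n\<^esub> trunc_class q n r"
  by (rule ring_hom_add[OF ring_hom_cring.homh[OF trunc_class_hom],
    unfolded carrier_mpoly_ring mpoly_ring_ops])

lemma trunc_class_uminus:
  "p \<in> polys_on (exponents n) \<Longrightarrow> trunc_class q n (- p) = \<ominus>\<^bsub>trunc_ring q n\<^esub> trunc_class q n p"
  using ring_hom_cring.hom_a_inv[OF trunc_class_hom[of n q], of p] uminus_mpoly_ring[of p n]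
  unfolding carrier_mpoly_ring by simp

lemma trunc_class_one: "trunc_class q n 1 = \<one>\<^bsub>trunc_ring q n\<^esub>"
  by (rule ring_hom_one[OF ring_hom_cring.homh[OF trunc_class_hom], unfolded mpoly_ring_ops])

lemma trunc_class_zero: "trunc_class q n 0 = \<zero>\<^bsub>trunc_ring q n\<^esub>"
  by (rule ring_hom_cring.hom_zero[OF trunc_class_hom, unfolded mpoly_ring_ops])

text \<open>The zero of the quotient is the ideal itself as a coset. The criterion serves both for
  the vanishing of high powers and for the nonvanishing of a product of two monomials.\<close>

lemma trunc_class_eq_zero_iff:
  fixes p :: "'f::field mpoly"
  assumes "p \<in> polys_on (exponents n)"
  shows "trunc_class q n p = \<zero>\<^bsub>trunc_ring q n\<^esub> \<longleftrightarrow> p \<in> polys_on (large_exponents q n)"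
proof -
  interpret ideal "trunc_ideal q n" "mpoly_ring n :: 'f mpoly ring" by (rule ideal_trunc_ideal)
  have "trunc_class q n p = trunc_ideal q n \<longleftrightarrow> p \<in> trunc_ideal q n"
    unfolding trunc_class_def using a_rcos_self[of p] a_rcos_const[of p] assms
    by (auto simp: carrier_mpoly_ring)
  then show ?thesis
    by (simp add: trunc_ring_def FactRing_def trunc_ideal_eq)
qed

text \<open>The class map is a ring homomorphism, so a product formed in the quotient is the class
  of a single term, with an exponent vector assembled from \<open>i\<close>.\<close>

lemma trunc_monom_eq:
  "trunc_monom q n i
    = trunc_class q n (Poly_Mapping.single (\<Sum>j\<in>{1..n}. Poly_Mapping.single j (i j)) (1 :: 'f::field))"
proof -
  interpret cring "trunc_ring q n :: 'f mpoly set ring" by (rule cring_trunc_ring)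
  let ?s = "\<lambda>j. Poly_Mapping.single j (i j)"
  have pow: "trunc_class q n (mpoly_var j :: 'f mpoly) [^]\<^bsub>trunc_ring q n\<^esub> (k::nat)
      = trunc_class q n (Poly_Mapping.single (Poly_Mapping.single j k) 1)" if "j \<in> {1..n}" for j k
  proof -
    have "(mpoly_var j :: 'f mpoly) \<in> carrier (mpoly_ring n)"
      using mpoly_var_power_carrier[OF that, of 1] by simp
    from ring_hom_cring.hom_pow[OF trunc_class_hom[of n q] this, of k] show ?thesis
      by (simp add: mpoly_ring_pow mpoly_var_power)
  qed
  have exps: "(\<Sum>j\<in>S. ?s j) \<in> exponents n" if "S \<subseteq> {1..n}" for S
  proof -
    have "Poly_Mapping.keys (\<Sum>j\<in>S. ?s j) \<subseteq> (\<Union>j\<in>S. Poly_Mapping.keys (?s j))"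
      by (rule keys_sum)
    also have "\<dots> \<subseteq> S"
      by (auto split: if_splits)
    finally show ?thesis
      using that by (auto simp: exponents_def)
  qed
  \<comment> \<open>Stated for subsets of \<open>{1..n}\<close> so that the variables can be
    inserted one by one.\<close>
  have "(\<Otimes>\<^bsub>trunc_ring q n\<^esub> j\<in>S. trunc_class q n (mpoly_var j :: 'f mpoly) [^]\<^bsub>trunc_ring q n\<^esub> i j)
      = trunc_class q n (Poly_Mapping.single (\<Sum>j\<in>S. ?s j) 1)" if "finite S" "S \<subseteq> {1..n}" for S
    using that
  proof (induction S rule: finite_induct)
    case empty
    then show ?case
      by (simp add: trunc_class_one)
  next
    case (insert j S)
    have carr: "trunc_class q n (mpoly_var k :: 'f mpoly) \<in> carrier (trunc_ring q n)" if "k \<in> {1..n}" for k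
      using mpoly_var_power_carrier[OF that, of 1]
      by (intro trunc_class_carrier) (simp add: carrier_mpoly_ring)
    have "(\<Otimes>\<^bsub>trunc_ring q n\<^esub> j\<in>insert j S. trunc_class q n (mpoly_var j :: 'f mpoly) [^]\<^bsub>trunc_ring q n\<^esub> i j)
        = trunc_class q n (mpoly_var j) [^]\<^bsub>trunc_ring q n\<^esub> i j \<otimes>\<^bsub>trunc_ring q n\<^esub>
          (\<Otimes>\<^bsub>trunc_ring q n\<^esub> j\<in>S. trunc_class q n (mpoly_var j) [^]\<^bsub>trunc_ring q n\<^esub> i j)"
      using insert.prems by (intro finprod_insert[OF insert.hyps] Pi_I nat_pow_closed carr) auto
    also have "\<dots> = trunc_class q n (Poly_Mapping.single (?s j) 1)
          \<otimes>\<^bsub>trunc_ring q n\<^esub> trunc_class q n (Poly_Mapping.single (\<Sum>j\<in>S. ?s j) 1)"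
      using insert.IH insert.prems pow[of j "i j"] by simp
    also have "\<dots> = trunc_class q n (Poly_Mapping.single (?s j) 1 * Poly_Mapping.single (\<Sum>j\<in>S. ?s j) 1)"
      using exps[of "{j}"] exps[of S] insert.prems
      by (intro trunc_class_mult[symmetric] polys_on_single) simp_all
    finally show ?case
      using insert.hyps by (simp add: mult_single)
  qed
  from this[of "{1..n}"] show ?thesis
    unfolding trunc_monom_def by simp
qed

section \<open>The algebra \<open>A(q,n,e)\<close>\<close>

text \<open>The linear form in the congruence that selects the generating monomials; the shift in
  \<open>j - 1\<close> reflects that variables are numbered from 1.\<close>

definition weight :: "nat \<Rightarrow> nat \<Rightarrow> (nat \<Rightarrow>\<^sub>0 nat) \<Rightarrow> nat" where
  "weight q n m = (\<Sum>j=1..n. q ^ (j - 1) * Poly_Mapping.lookup m j)"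

definition total_degree :: "nat \<Rightarrow> (nat \<Rightarrow>\<^sub>0 nat) \<Rightarrow> nat" where
  "total_degree n m = (\<Sum>j=1..n. Poly_Mapping.lookup m j)"

lemma weight_zero [simp]: "weight q n 0 = 0"
  by (simp add: weight_def)

lemma weight_add: "weight q n (a + b) = weight q n a + weight q n b"
  by (simp add: weight_def lookup_add distrib_left sum.distrib)

lemma total_degree_add: "total_degree n (a + b) = total_degree n a + total_degree n b"
  by (simp add: total_degree_def lookup_add sum.distrib)

lemma weight_pos:
  assumes "q > 0" "m \<in> exponents n" "m \<noteq> 0"
  shows "weight q n m > 0"
proof -
  obtain j where "j \<in> {1..n}" "Poly_Mapping.lookup m j > 0"
    using assms(2,3) by (rule exponents_nonzeroE)
  then show ?thesis
    unfolding weight_def using assms(1) by (intro sum_pos2[of _ j]) auto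
qed

lemma total_degree_pos:
  assumes "m \<in> exponents n" "m \<noteq> 0"
  shows "total_degree n m > 0"
proof -
  obtain j where "j \<in> {1..n}" "Poly_Mapping.lookup m j > 0"
    using assms by (rule exponents_nonzeroE)
  then show ?thesis
    unfolding total_degree_def by (intro sum_pos2[of _ j]) auto
qed

definition graded_exponents :: "nat \<Rightarrow> nat \<Rightarrow> nat \<Rightarrow> (nat \<Rightarrow>\<^sub>0 nat) set" where
  "graded_exponents q n e = {m \<in> exponents n. e dvd weight q n m}"

definition high_exponents :: "nat \<Rightarrow> nat \<Rightarrow> (nat \<Rightarrow>\<^sub>0 nat) set" where
  "high_exponents n k = {m \<in> exponents n. k \<le> total_degree n m}"

lemma graded_exponents_subset: "graded_exponents q n e \<subseteq> exponents n"
  by (auto simp: graded_exponents_def)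

lemma high_exponents_subset: "high_exponents n k \<subseteq> exponents n"
  by (auto simp: high_exponents_def)

text \<open>If all \<open>n\<close> components were at most \<open>q - 1\<close>, the degree would
  be at most \<open>n * (q - 1)\<close>.\<close>

lemma high_exponents_subset_large:
  assumes "n * (q - 1) < k"
  shows "high_exponents n k \<subseteq> large_exponents q n"
proof
  fix m assume m: "m \<in> high_exponents n k"
  show "m \<in> large_exponents q n"
  proof (rule ccontr)
    assume "m \<notin> large_exponents q n"
    then have "\<forall>j\<in>{1..n}. Poly_Mapping.lookup m j \<le> q - 1"
      using m by (force simp: large_exponents_def high_exponents_def)
    then have "total_degree n m \<le> n * (q - 1)"
      unfolding total_degree_def using sum_bounded_above[of "{1..n}" "Poly_Mapping.lookup m" "q - 1"]
      by simp
    then show False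
      using m assms by (simp add: high_exponents_def)
  qed
qed

lemma graded_exponents_add:
  "a \<in> graded_exponents q n e \<Longrightarrow> b \<in> graded_exponents q n e \<Longrightarrow> a + b \<in> graded_exponents q n e"
  by (simp add: graded_exponents_def exponents_add weight_add)

lemma high_exponents_add:
  "a \<in> high_exponents n k \<Longrightarrow> b \<in> high_exponents n l \<Longrightarrow> a + b \<in> high_exponents n (k + l)"
  by (simp add: high_exponents_def exponents_add total_degree_add)

section \<open>Generators and elements of A(q,n,e)\<close>

definition alg_gens :: "nat \<Rightarrow> nat \<Rightarrow> nat \<Rightarrow> 'f::field mpoly set set" where
  "alg_gens q n e = {trunc_class q n (mpoly_const c) | c. True} \<union>
     {trunc_monom q n i | i. [(\<Sum>j=1..n. q ^ (j - 1) * i j) = 0] (mod e)}"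

lemma carrier_alg_A: "carrier (alg_A q n e) = generate_ring (trunc_ring q n) (alg_gens q n e)"
  by (simp add: alg_A_def alg_gens_def)

lemma alg_A_ops [simp]:
  "x \<otimes>\<^bsub>alg_A q n e\<^esub> y = x \<otimes>\<^bsub>trunc_ring q n\<^esub> y" "x \<oplus>\<^bsub>alg_A q n e\<^esub> y = x \<oplus>\<^bsub>trunc_ring q n\<^esub> y"
  "\<one>\<^bsub>alg_A q n e\<^esub> = \<one>\<^bsub>trunc_ring q n\<^esub>" "\<zero>\<^bsub>alg_A q n e\<^esub> = \<zero>\<^bsub>trunc_ring q n\<^esub>"
  by (simp_all add: alg_A_def)

lemma exponent_vector:
  fixes i :: "nat \<Rightarrow> nat" and n :: nat
  defines "m \<equiv> \<Sum>j\<in>{1..n}. Poly_Mapping.single j (i j)"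
  shows "m \<in> exponents n" "\<And>j. j \<in> {1..n} \<Longrightarrow> Poly_Mapping.lookup m j = i j"
    "weight q n m = (\<Sum>j=1..n. q ^ (j - 1) * i j)"
proof -
  have lookup: "Poly_Mapping.lookup m j = (if j \<in> {1..n} then i j else 0)" for j
    by (simp add: m_def lookup_sum lookup_single when_def)
  then show "m \<in> exponents n" "\<And>j. j \<in> {1..n} \<Longrightarrow> Poly_Mapping.lookup m j = i j"
    by (auto simp: exponents_def in_keys_iff split: if_splits)
  show "weight q n m = (\<Sum>j=1..n. q ^ (j - 1) * i j)"
    unfolding weight_def by (rule sum.cong) (simp_all add: lookup)
qed

lemma alg_gens_graded:
  "alg_gens q n e \<subseteq> trunc_class q n ` (polys_on (graded_exponents q n e) :: 'f::field mpoly set)"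
proof
  fix x :: "'f mpoly set" assume "x \<in> alg_gens q n e"
  then consider c where "x = trunc_class q n (Poly_Mapping.single 0 c)"
    | i where "x = trunc_monom q n i" "e dvd (\<Sum>j=1..n. q ^ (j - 1) * i j)"
    by (auto simp: alg_gens_def mpoly_const_def cong_0_iff)
  then show "x \<in> trunc_class q n ` polys_on (graded_exponents q n e)"
  proof cases
    case 1
    show ?thesis
      unfolding 1 by (intro imageI polys_on_single) (simp add: graded_exponents_def)
  next
    case 2
    show ?thesis
      unfolding 2(1) trunc_monom_eq using 2(2)
      by (intro imageI polys_on_single) (simp add: graded_exponents_def exponent_vector del: One_nat_def)
  qed
qed

lemma polys_on_graded_subset: "polys_on (graded_exponents q n e) \<subseteq> polys_on (exponents n)"
  by (rule polys_on_mono[OF graded_exponents_subset])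

lemma alg_gens_carrier: "(alg_gens q n e :: 'f::field mpoly set set) \<subseteq> carrier (trunc_ring q n)"
proof
  fix x :: "'f mpoly set" assume "x \<in> alg_gens q n e"
  then obtain p :: "'f mpoly" where "p \<in> polys_on (graded_exponents q n e)" "x = trunc_class q n p"
    using alg_gens_graded by blast
  then show "x \<in> carrier (trunc_ring q n)"
    using trunc_class_carrier polys_on_graded_subset by blast
qed

lemma cring_alg_A: "cring (alg_A q n e :: 'f::field mpoly set ring)"
proof -
  interpret T: cring "trunc_ring q n :: 'f mpoly set ring" by (rule cring_trunc_ring)
  let ?G = "generate_ring (trunc_ring q n) (alg_gens q n e :: 'f mpoly set set)"
  have "subring ?G (trunc_ring q n)"
    by (rule T.generate_ring_is_subring[OF alg_gens_carrier])
  then have "cring ((trunc_ring q n) \<lparr> carrier := ?G \<rparr>)"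
    using T.subcring_iff[OF T.generate_ring_incl[OF alg_gens_carrier]] T.subcringI' by blast
  then show ?thesis
    by (simp add: alg_A_def alg_gens_def)
qed

text \<open>Membership in the algebra is required separately from the representative, so that
  \<open>S\<close> may be a set such as \<open>high_exponents n k\<close>, which also contains
  exponents of weight not divisible by \<open>e\<close>.\<close>

definition alg_part :: "nat \<Rightarrow> nat \<Rightarrow> nat \<Rightarrow> (nat \<Rightarrow>\<^sub>0 nat) set \<Rightarrow> 'f::field mpoly set set" where
  "alg_part q n e S = {x \<in> carrier (alg_A q n e). \<exists>p\<in>polys_on S. x = trunc_class q n p}"

lemma alg_partI:
  "x \<in> carrier (alg_A q n e) \<Longrightarrow> p \<in> polys_on S \<Longrightarrow> x = trunc_class q n p \<Longrightarrow> x \<in> alg_part q n e S"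
  by (auto simp: alg_part_def)

lemma alg_partE:
  assumes "x \<in> alg_part q n e S"
  obtains p where "x \<in> carrier (alg_A q n e)" "p \<in> polys_on S" "x = trunc_class q n p"
  using assms by (auto simp: alg_part_def)

lemma alg_part_mono: "S \<subseteq> T \<Longrightarrow> alg_part q n e S \<subseteq> alg_part q n e T"
  unfolding alg_part_def using polys_on_mono[of S T] by blast

text \<open>Classes of polynomials with graded exponents include the generators and are closed under
  the ring operations, since weights add under multiplication and divisibility by \<open>e\<close>
  is preserved.\<close>

lemma carrier_alg_A_eq:
  "carrier (alg_A q n e) = (alg_part q n e (graded_exponents q n e) :: 'f::field mpoly set set)"
proof
  show "alg_part q n e (graded_exponents q n e) \<subseteq> carrier (alg_A q n e :: 'f mpoly set ring)"
    by (auto simp: alg_part_def)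
  have "\<exists>p\<in>polys_on (graded_exponents q n e). x = trunc_class q n p"
    if "x \<in> generate_ring (trunc_ring q n) (alg_gens q n e)" for x :: "'f mpoly set"
    using that
  proof (induction rule: generate_ring.induct)
    case one
    show ?case
      by (rule bexI[of _ 1]) (simp_all add: trunc_class_one polys_on_one graded_exponents_def)
  next
    case (incl h)
    then show ?case
      using alg_gens_graded by blast
  next
    case (a_inv h)
    then obtain p :: "'f mpoly" where "p \<in> polys_on (graded_exponents q n e)" "h = trunc_class q n p"
      by blast
    then show ?case
      using polys_on_graded_subset[THEN subsetD, of p q n e]
      by (intro bexI[of _ "- p"]) (simp_all add: polys_on_uminus trunc_class_uminus)
  next
    case (eng_add h1 h2)
    then obtain p r :: "'f mpoly" where
      "p \<in> polys_on (graded_exponents q n e)" "h1 = trunc_class q n p"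
      "r \<in> polys_on (graded_exponents q n e)" "h2 = trunc_class q n r"
      by blast
    then show ?case
      using polys_on_graded_subset[THEN subsetD, of p q n e] polys_on_graded_subset[THEN subsetD, of r q n e]
      by (intro bexI[of _ "p + r"]) (simp_all add: polys_on_add trunc_class_add)
  next
    case (eng_mult h1 h2)
    then obtain p r :: "'f mpoly" where pr:
      "p \<in> polys_on (graded_exponents q n e)" "h1 = trunc_class q n p"
      "r \<in> polys_on (graded_exponents q n e)" "h2 = trunc_class q n r"
      by blast
    then have "p * r \<in> polys_on (graded_exponents q n e)"
      by (blast intro: polys_on_mult graded_exponents_add)
    then show ?case
      using pr polys_on_graded_subset[THEN subsetD, of p q n e] polys_on_graded_subset[THEN subsetD, of r q n e]
      by (intro bexI[of _ "p * r"]) (simp_all add: trunc_class_mult)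
  qed
  then show "carrier (alg_A q n e :: 'f mpoly set ring) \<subseteq> alg_part q n e (graded_exponents q n e)"
    unfolding alg_part_def carrier_alg_A by blast
qed

lemma alg_part_zero: "\<zero>\<^bsub>trunc_ring q n\<^esub> \<in> (alg_part q n e S :: 'f::field mpoly set set)"
proof (rule alg_partI)
  show "\<zero>\<^bsub>trunc_ring q n\<^esub> \<in> carrier (alg_A q n e :: 'f mpoly set ring)"
    using cring.cring_simprules(2)[OF cring_alg_A] by simp
  show "0 \<in> polys_on S"
    by (rule polys_on_zero)
qed (rule trunc_class_zero[symmetric])

lemma alg_part_add:
  fixes x y :: "'f::field mpoly set"
  assumes "S \<subseteq> exponents n" "x \<in> alg_part q n e S" "y \<in> alg_part q n e S"
  shows "x \<oplus>\<^bsub>trunc_ring q n\<^esub> y \<in> alg_part q n e S"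
proof -
  interpret A: cring "alg_A q n e :: 'f mpoly set ring" by (rule cring_alg_A)
  obtain p r where pr: "p \<in> polys_on S" "r \<in> polys_on S" "x = trunc_class q n p" "y = trunc_class q n r"
    "x \<in> carrier (alg_A q n e)" "y \<in> carrier (alg_A q n e)"
    using assms(2,3) by (elim alg_partE) blast
  have "p \<in> polys_on (exponents n)" "r \<in> polys_on (exponents n)"
    using pr polys_on_mono[OF assms(1)] by blast+
  then have "x \<oplus>\<^bsub>trunc_ring q n\<^esub> y = trunc_class q n (p + r)"
    by (simp add: pr trunc_class_add)
  then show ?thesis
    using A.a_closed[of x y] pr by (intro alg_partI[of _ _ _ _ "p + r"] polys_on_add) simp_all
qed

lemma alg_part_mult:
  fixes x y :: "'f::field mpoly set"
  assumes "S \<subseteq> exponents n" "T \<subseteq> exponents n" "x \<in> alg_part q n e S" "y \<in> alg_part q n e T"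
    and "\<And>a b. a \<in> S \<Longrightarrow> b \<in> T \<Longrightarrow> a + b \<in> U"
  shows "x \<otimes>\<^bsub>trunc_ring q n\<^esub> y \<in> alg_part q n e U"
proof -
  interpret A: cring "alg_A q n e :: 'f mpoly set ring" by (rule cring_alg_A)
  obtain p r where pr: "p \<in> polys_on S" "r \<in> polys_on T" "x = trunc_class q n p" "y = trunc_class q n r"
    "x \<in> carrier (alg_A q n e)" "y \<in> carrier (alg_A q n e)"
    using assms(3,4) by (elim alg_partE) blast
  have "p \<in> polys_on (exponents n)" "r \<in> polys_on (exponents n)"
    using pr polys_on_mono[OF assms(1)] polys_on_mono[OF assms(2)] by blast+
  then have "x \<otimes>\<^bsub>trunc_ring q n\<^esub> y = trunc_class q n (p * r)"
    by (simp add: pr trunc_class_mult)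
  then show ?thesis
    using A.m_closed[of x y] pr assms(5)
    by (intro alg_partI[of _ _ _ _ "p * r"] polys_on_mult[of p S r T]) simp_all
qed

lemma alg_part_a_inv:
  fixes x :: "'f::field mpoly set"
  assumes "S \<subseteq> exponents n" "x \<in> alg_part q n e S"
  shows "\<ominus>\<^bsub>alg_A q n e\<^esub> x \<in> alg_part q n e S"
proof -
  interpret A: cring "alg_A q n e :: 'f mpoly set ring" by (rule cring_alg_A)
  interpret T: cring "trunc_ring q n :: 'f mpoly set ring" by (rule cring_trunc_ring)
  obtain p where p: "p \<in> polys_on S" "x = trunc_class q n p" "x \<in> carrier (alg_A q n e)"
    using assms(2) by (rule alg_partE)
  have pn: "p \<in> polys_on (exponents n)"
    using p polys_on_mono[OF assms(1)] by blast
  have inv: "\<ominus>\<^bsub>trunc_ring q n\<^esub> x \<in> carrier (alg_A q n e)"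
    using p(3) unfolding carrier_alg_A by (rule generate_ring.a_inv)
  \<comment> \<open>By uniqueness of additive inverses, negation in the subalgebra agrees with
    negation in the ambient quotient, which acts on representatives.\<close>
  have "\<ominus>\<^bsub>trunc_ring q n\<^esub> x \<oplus>\<^bsub>trunc_ring q n\<^esub> x = \<zero>\<^bsub>trunc_ring q n\<^esub>"
    using trunc_class_carrier[OF pn, of q] by (simp add: p(2) T.l_neg)
  then have "\<ominus>\<^bsub>alg_A q n e\<^esub> x = \<ominus>\<^bsub>trunc_ring q n\<^esub> x"
    using p(3) inv by (intro A.minus_equality) simp_all
  also have "\<dots> = trunc_class q n (- p)"
    by (simp add: p(2) trunc_class_uminus[OF pn])
  finally have "\<ominus>\<^bsub>alg_A q n e\<^esub> x = trunc_class q n (- p)" .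
  then show ?thesis
    using p A.a_inv_closed by (intro alg_partI[of _ _ _ _ "- p"] polys_on_uminus)
qed

text \<open>An ideal product arises from products of elements by repeated addition, so it suffices
  to control exponents under single products. This carries degree bounds over to products of
  ideals.\<close>

lemma ideal_prod_alg_part:
  fixes I J :: "'f::field mpoly set set"
  assumes "S \<subseteq> exponents n" "T \<subseteq> exponents n" "U \<subseteq> exponents n"
    and "I \<subseteq> alg_part q n e S" "J \<subseteq> alg_part q n e T"
    and "\<And>a b. a \<in> S \<Longrightarrow> b \<in> T \<Longrightarrow> a + b \<in> U"
  shows "ideal_prod (alg_A q n e) I J \<subseteq> alg_part q n e U"
proof
  fix x assume "x \<in> ideal_prod (alg_A q n e) I J"
  then show "x \<in> alg_part q n e U"
  proof (induction rule: ideal_prod.induct)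
    case (prod i j)
    have "i \<otimes>\<^bsub>trunc_ring q n\<^esub> j \<in> alg_part q n e U"
      using assms(1,2) by (rule alg_part_mult) (use prod assms(4,5,6) in auto)
    then show ?case
      by simp
  next
    case (sum s1 s2)
    then show ?case
      using alg_part_add[OF assms(3)] by simp
  qed
qed

section \<open>The classes without constant term and the Jacobson radical\<close>

definition alg_max :: "nat \<Rightarrow> nat \<Rightarrow> nat \<Rightarrow> 'f::field mpoly set set" where
  "alg_max q n e = alg_part q n e (graded_exponents q n e - {0})"

lemma alg_max_subset_high: "alg_max q n e \<subseteq> alg_part q n e (high_exponents n 1)"
  unfolding alg_max_def
proof (rule alg_part_mono, rule subsetI)
  fix m assume "m \<in> graded_exponents q n e - {0}"
  then show "m \<in> high_exponents n 1"
    using total_degree_pos[of m n] by (auto simp: high_exponents_def graded_exponents_def)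
qed

lemma alg_part_large: "x \<in> alg_part q n e (large_exponents q n) \<Longrightarrow> x = \<zero>\<^bsub>trunc_ring q n\<^esub>"
proof (elim alg_partE)
  fix p :: "'a mpoly"
  assume p: "p \<in> polys_on (large_exponents q n)" "x = trunc_class q n p"
  then have "p \<in> polys_on (exponents n)"
    using polys_on_mono[of "large_exponents q n" "exponents n"] by (auto simp: large_exponents_def)
  then show ?thesis
    using p trunc_class_eq_zero_iff by blast
qed

lemma ideal_alg_max:
  assumes "q > 0"
  shows "ideal (alg_max q n e) (alg_A q n e :: 'f::field mpoly set ring)"
proof (rule idealI)
  interpret A: cring "alg_A q n e :: 'f mpoly set ring" by (rule cring_alg_A)
  show "ring (alg_A q n e :: 'f mpoly set ring)"
    by (rule A.ring_axioms)
  have S: "graded_exponents q n e - {0} \<subseteq> exponents n"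
    using graded_exponents_subset by blast
  show "subgroup (alg_max q n e) (add_monoid (alg_A q n e :: 'f mpoly set ring))"
  proof (rule A.add.subgroupI)
    show "alg_max q n e \<subseteq> carrier (alg_A q n e :: 'f mpoly set ring)"
      by (auto simp: alg_max_def alg_part_def)
    show "alg_max q n e \<noteq> ({} :: 'f mpoly set set)"
      unfolding alg_max_def using alg_part_zero by blast
    fix a b :: "'f mpoly set"
    assume a: "a \<in> alg_max q n e"
    then show "\<ominus>\<^bsub>alg_A q n e\<^esub> a \<in> alg_max q n e"
      unfolding alg_max_def by (rule alg_part_a_inv[OF S])
    assume "b \<in> alg_max q n e"
    then show "a \<oplus>\<^bsub>alg_A q n e\<^esub> b \<in> alg_max q n e"
      using a unfolding alg_max_def by (simp add: alg_part_add[OF S])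
  qed
  fix a x :: "'f mpoly set"
  assume a: "a \<in> alg_max q n e" and x: "x \<in> carrier (alg_A q n e)"
  \<comment> \<open>The weight of \<open>b\<close> is positive, so the sum cannot be the zero
    vector.\<close>
  have sum: "b + c \<in> graded_exponents q n e - {0}"
    if "b \<in> graded_exponents q n e - {0}" "c \<in> graded_exponents q n e" for b c
  proof -
    have "weight q n (b + c) > 0"
      using that weight_pos[OF assms, of b n] by (auto simp: weight_add graded_exponents_def)
    then have "b + c \<noteq> 0"
      by (metis weight_zero less_irrefl)
    then show ?thesis
      using that graded_exponents_add by blast
  qed
  have "a \<otimes>\<^bsub>trunc_ring q n\<^esub> x \<in> alg_max q n e"
    using alg_part_mult[OF S graded_exponents_subset, of a q e x] a x sum
    unfolding alg_max_def carrier_alg_A_eq by blast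
  then show "a \<otimes>\<^bsub>alg_A q n e\<^esub> x \<in> alg_max q n e"
    by simp
  moreover have "a \<in> carrier (alg_A q n e)"
    using a by (auto simp: alg_max_def alg_part_def)
  ultimately show "x \<otimes>\<^bsub>alg_A q n e\<^esub> a \<in> alg_max q n e"
    using A.m_comm[OF _ x, of a] by simp
qed

text \<open>Representatives are not unique, so 1 is compared with \<open>p\<close> modulo the
  truncation ideal: \<open>1 - p\<close> would have constant term 1, but the zero vector is not
  large because \<open>q > 0\<close>.\<close>

lemma one_notin_alg_max:
  assumes "q > 0"
  shows "\<one>\<^bsub>trunc_ring q n\<^esub> \<notin> (alg_max q n e :: 'f::field mpoly set set)"
proof
  interpret T: cring "trunc_ring q n :: 'f mpoly set ring" by (rule cring_trunc_ring)
  assume "\<one>\<^bsub>trunc_ring q n\<^esub> \<in> (alg_max q n e :: 'f mpoly set set)"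
  then obtain p :: "'f mpoly" where p: "p \<in> polys_on (graded_exponents q n e - {0})"
    "\<one>\<^bsub>trunc_ring q n\<^esub> = trunc_class q n p"
    unfolding alg_max_def by (rule alg_partE)
  have pn: "p \<in> polys_on (exponents n)"
    using p(1) polys_on_mono[of "graded_exponents q n e - {0}" "exponents n"] graded_exponents_subset
    by blast
  have one: "(1 :: 'f mpoly) \<in> polys_on (exponents n)"
    by (rule polys_on_one) simp
  have "trunc_class q n (1 + - p) = trunc_class q n 1 \<oplus>\<^bsub>trunc_ring q n\<^esub> trunc_class q n (- p)"
    using one pn by (intro trunc_class_add polys_on_uminus)
  also have "\<dots> = \<zero>\<^bsub>trunc_ring q n\<^esub>"
    by (simp add: trunc_class_one trunc_class_uminus[OF pn] p(2)[symmetric] T.r_neg)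
  finally have "1 + - p \<in> polys_on (large_exponents q n)"
    using trunc_class_eq_zero_iff[of "1 + - p" n q] one pn polys_on_add polys_on_uminus by blast
  moreover have "Poly_Mapping.lookup p 0 = 0"
    using p(1) by (auto simp: polys_on_def in_keys_iff)
  then have "0 \<in> Poly_Mapping.keys (1 + - p)"
    by (simp add: in_keys_iff lookup_minus)
  ultimately have "0 \<in> large_exponents q n"
    unfolding polys_on_def by blast
  then show False
    using assms by (simp add: large_exponents_def)
qed

text \<open>A \<open>k\<close>-th power of an element without constant term has a representative of
  degree at least \<open>k\<close> in every term and vanishes once \<open>k\<close> exceeds
  \<open>n * (q - 1)\<close>. Any other element has a nonzero constant term, which is invertible in
  the field.\<close>

lemma jacobson_radical_alg_A:
  assumes "q > 0"
  shows "jacobson_radical (alg_A q n e :: 'f::field mpoly set ring) = alg_max q n e"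
proof -
  interpret A: cring "alg_A q n e :: 'f mpoly set ring" by (rule cring_alg_A)
  interpret M: ideal "alg_max q n e" "alg_A q n e :: 'f mpoly set ring"
    by (rule ideal_alg_max[OF assms])
  show ?thesis
  proof (rule A.jacobson_radical_eqI[OF M.is_ideal])
    show "\<one>\<^bsub>alg_A q n e\<^esub> \<notin> (alg_max q n e :: 'f mpoly set set)"
      using one_notin_alg_max[OF assms] by simp
  next
    fix x :: "'f mpoly set" assume x: "x \<in> alg_max q n e"
    have "x [^]\<^bsub>alg_A q n e\<^esub> k \<in> alg_part q n e (high_exponents n k)" for k :: nat
    proof (induction k)
      case 0
      have "graded_exponents q n e \<subseteq> high_exponents n 0"
        by (auto simp: graded_exponents_def high_exponents_def)
      then have "carrier (alg_A q n e) \<subseteq> (alg_part q n e (high_exponents n 0) :: 'f mpoly set set)"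
        unfolding carrier_alg_A_eq by (rule alg_part_mono)
      then show ?case
        using A.one_closed by (simp only: nat_pow_0) (rule subsetD)
    next
      case (Suc k)
      have "x [^]\<^bsub>alg_A q n e\<^esub> k \<otimes>\<^bsub>trunc_ring q n\<^esub> x \<in> alg_part q n e (high_exponents n (k + 1))"
        using high_exponents_subset high_exponents_subset Suc subsetD[OF alg_max_subset_high x]
        by (rule alg_part_mult) (rule high_exponents_add)
      then show ?case
        by simp
    qed
    from this[of "Suc (n * (q - 1))"]
    have "x [^]\<^bsub>alg_A q n e\<^esub> Suc (n * (q - 1)) \<in> alg_part q n e (large_exponents q n)"
      using alg_part_mono[OF high_exponents_subset_large[OF lessI, of n q]] by blast
    then show "\<exists>k::nat. x [^]\<^bsub>alg_A q n e\<^esub> k = \<zero>\<^bsub>alg_A q n e\<^esub>"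
      using alg_part_large by (intro exI[of _ "Suc (n * (q - 1))"]) (simp only: alg_A_ops)
  next
    fix x :: "'f mpoly set" assume x: "x \<in> carrier (alg_A q n e)" "x \<notin> alg_max q n e"
    then obtain p where p: "p \<in> polys_on (graded_exponents q n e)" "x = trunc_class q n p"
      unfolding carrier_alg_A_eq by (blast elim: alg_partE)
    define c where "c = Poly_Mapping.lookup p 0"
    have "c \<noteq> 0"
    proof
      assume "c = 0"
      then have "p \<in> polys_on (graded_exponents q n e - {0})"
        using p(1) by (auto simp: polys_on_def c_def in_keys_iff)
      then show False
        using x p(2) unfolding alg_max_def by (blast intro: alg_partI)
    qed
    \<comment> \<open>Multiplying by \<open>u\<close> normalises the constant term to 1, so
      subtracting 1 leaves a representative without constant term.\<close>
    define u where "u = trunc_class q n (Poly_Mapping.single 0 (inverse c))"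
    have u: "u \<in> carrier (alg_A q n e)"
      unfolding u_def carrier_alg_A
      by (rule generate_ring.incl) (auto simp: alg_gens_def mpoly_const_def)
    let ?r = "Poly_Mapping.single 0 (inverse c) * p"
    have zero: "0 \<in> graded_exponents q n e"
      by (simp add: graded_exponents_def)
    have r: "?r \<in> polys_on (graded_exponents q n e)"
      using polys_on_single[OF zero] p(1) by (rule polys_on_mult) (rule graded_exponents_add)
    have "u \<otimes>\<^bsub>alg_A q n e\<^esub> x = trunc_class q n ?r"
      unfolding u_def p(2) alg_A_ops using p(1) polys_on_graded_subset
      by (intro trunc_class_mult[symmetric] polys_on_single) auto
    moreover have "\<ominus>\<^bsub>alg_A q n e\<^esub> \<one>\<^bsub>alg_A q n e\<^esub> = trunc_class q n (- 1 :: 'f mpoly)"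
    proof (rule A.minus_equality)
      have one: "(1 :: 'f mpoly) \<in> polys_on (exponents n)"
        by (rule polys_on_one) simp
      interpret T: cring "trunc_ring q n :: 'f mpoly set ring" by (rule cring_trunc_ring)
      show "trunc_class q n (- 1) \<in> carrier (alg_A q n e :: 'f mpoly set ring)"
        unfolding trunc_class_uminus[OF one] trunc_class_one carrier_alg_A
        by (intro generate_ring.a_inv generate_ring.one)
      show "trunc_class q n (- 1) \<oplus>\<^bsub>alg_A q n e\<^esub> \<one>\<^bsub>alg_A q n e\<^esub> = (\<zero>\<^bsub>alg_A q n e\<^esub> :: 'f mpoly set)"
        by (simp add: trunc_class_uminus[OF one] trunc_class_one T.l_neg)
    qed (rule A.one_closed)
    ultimately have "u \<otimes>\<^bsub>alg_A q n e\<^esub> x \<ominus>\<^bsub>alg_A q n e\<^esub> \<one>\<^bsub>alg_A q n e\<^esub>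
        = trunc_class q n ?r \<oplus>\<^bsub>trunc_ring q n\<^esub> trunc_class q n (- 1)"
      unfolding a_minus_def by simp
    also have "\<dots> = trunc_class q n (?r + - 1)"
      using r polys_on_graded_subset
      by (intro trunc_class_add[symmetric] polys_on_uminus polys_on_one) auto
    finally have eq: "u \<otimes>\<^bsub>alg_A q n e\<^esub> x \<ominus>\<^bsub>alg_A q n e\<^esub> \<one>\<^bsub>alg_A q n e\<^esub> = trunc_class q n (?r + - 1)" .
    have "?r + - 1 \<in> polys_on (graded_exponents q n e)"
      using r zero by (intro polys_on_add polys_on_uminus polys_on_one)
    moreover have "Poly_Mapping.lookup (?r + - 1) 0 = 0"
      using \<open>c \<noteq> 0\<close> by (simp add: lookup_minus lookup_single_0_mult c_def[symmetric])
    ultimately have r1: "?r + - 1 \<in> polys_on (graded_exponents q n e - {0})"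
      by (auto simp: polys_on_def in_keys_iff)
    have "u \<otimes>\<^bsub>alg_A q n e\<^esub> x \<ominus>\<^bsub>alg_A q n e\<^esub> \<one>\<^bsub>alg_A q n e\<^esub> \<in> carrier (alg_A q n e)"
      using u x(1) by (intro A.minus_closed A.m_closed A.one_closed)
    then have "u \<otimes>\<^bsub>alg_A q n e\<^esub> x \<ominus>\<^bsub>alg_A q n e\<^esub> \<one>\<^bsub>alg_A q n e\<^esub> \<in> alg_max q n e"
      unfolding alg_max_def by (rule alg_partI[OF _ r1 eq])
    with u show "\<exists>u\<in>carrier (alg_A q n e).
        u \<otimes>\<^bsub>alg_A q n e\<^esub> x \<ominus>\<^bsub>alg_A q n e\<^esub> \<one>\<^bsub>alg_A q n e\<^esub> \<in> alg_max q n e" ..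
  qed
qed

section \<open>Monomials in the radical and the Loewy length\<close>

lemma trunc_monom_in_alg_max:
  assumes "e dvd (\<Sum>j=1..n. q ^ (j - 1) * i j)" "(\<Sum>j=1..n. q ^ (j - 1) * i j) > 0"
  shows "trunc_monom q n i \<in> (alg_max q n e :: 'f::field mpoly set set)"
  unfolding alg_max_def
proof (rule alg_partI[OF _ _ trunc_monom_eq])
  show "trunc_monom q n i \<in> carrier (alg_A q n e :: 'f mpoly set ring)"
    unfolding carrier_alg_A using assms(1)
    by (intro generate_ring.incl) (auto simp: alg_gens_def cong_0_iff)
  let ?m = "\<Sum>j\<in>{1..n}. Poly_Mapping.single j (i j)"
  have "weight q n ?m > 0"
    using assms(2) by (simp only: exponent_vector)
  then have "?m \<noteq> 0"
    by (metis weight_zero less_irrefl)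
  moreover have "?m \<in> graded_exponents q n e"
    using assms(1) by (simp only: graded_exponents_def mem_Collect_eq exponent_vector simp_thms)
  ultimately show "Poly_Mapping.single ?m (1::'f) \<in> polys_on (graded_exponents q n e - {0})"
    by (intro polys_on_single) simp
qed

text \<open>Exponents add in the product, so all of them stay below \<open>q\<close> and the
  resulting term is not in the truncation ideal.\<close>

lemma trunc_monom_mult_nonzero:
  assumes "\<And>j. j \<in> {1..n} \<Longrightarrow> i j + i' j < q"
  shows "trunc_monom q n i \<otimes>\<^bsub>trunc_ring q n\<^esub> trunc_monom q n i' \<noteq> (\<zero>\<^bsub>trunc_ring q n\<^esub> :: 'f::field mpoly set)"
proof
  let ?m = "\<Sum>j\<in>{1..n}. Poly_Mapping.single j (i j)"
  let ?m' = "\<Sum>j\<in>{1..n}. Poly_Mapping.single j (i' j)"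
  assume zero: "trunc_monom q n i \<otimes>\<^bsub>trunc_ring q n\<^esub> trunc_monom q n i' = (\<zero>\<^bsub>trunc_ring q n\<^esub> :: 'f mpoly set)"
  have exps: "?m \<in> exponents n" "?m' \<in> exponents n" "?m + ?m' \<in> exponents n"
    by (intro exponents_add exponent_vector)+
  have "trunc_class q n (Poly_Mapping.single (?m + ?m') (1::'f)) =
      trunc_class q n (Poly_Mapping.single ?m 1 * Poly_Mapping.single ?m' 1)"
    by (simp add: mult_single)
  also have "\<dots> = trunc_monom q n i \<otimes>\<^bsub>trunc_ring q n\<^esub> trunc_monom q n i'"
    unfolding trunc_monom_eq using exps by (intro trunc_class_mult polys_on_single)
  finally have "Poly_Mapping.single (?m + ?m') (1::'f) \<in> polys_on (large_exponents q n)"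
    using zero trunc_class_eq_zero_iff[OF polys_on_single[OF exps(3), of "1::'f"], of q] by simp
  then have "?m + ?m' \<in> large_exponents q n"
    by (simp add: polys_on_def)
  then obtain j where "j \<in> {1..n}" "q \<le> Poly_Mapping.lookup (?m + ?m') j"
    unfolding large_exponents_def by blast
  then show False
    using assms[of j] exponent_vector(2)[of j n] by (simp only: lookup_add) (simp add: not_less)
qed

lemma loewy_length_alg_A:
  assumes q: "q > 1" and h: "h > 0" and n: "n = 2 * h"
    and dvd: "(q ^ h - 1) dvd e" "e dvd q ^ n - 1" and e: "e > 0" "e \<noteq> q ^ n - 1"
  shows "loewy_length (alg_A q n e :: 'f::field mpoly set ring) = 3"
proof -
  interpret A: cring "alg_A q n e :: 'f mpoly set ring" by (rule cring_alg_A)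
  have q0: "q > 0"
    using q by simp
  \<comment> \<open>Half of \<open>n * (q - 1)\<close>, the largest degree of a nonzero monomial in
    the truncated ring.\<close>
  define N where "N = h * (q - 1)"
  \<comment> \<open>The base-\<open>q\<close> digits of \<open>e\<close>, with indices shifted to
    start at 1. Their complements \<open>i'\<close> are then the digits of
    \<open>q ^ n - 1 - e\<close>.\<close>
  define i where "i j = (e div q ^ (j - 1)) mod q" for j
  define i' where "i' j = q - 1 - i j" for j
  have i_less: "i j < q" for j
    using q by (simp add: i_def)
  have "q ^ n > 1"
    using q h n by (intro one_less_power) auto
  have "e \<le> q ^ n - 1"
    using dvd(2) \<open>q ^ n > 1\<close> by (intro dvd_imp_le) auto
  then have e_less: "e < q ^ n - 1"
    using e(2) by simp
  have wi: "(\<Sum>j=1..n. q ^ (j - 1) * i j) = e"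
  proof -
    have "(\<Sum>j=1..n. q ^ (j - 1) * i j) = (\<Sum>j<n. q ^ j * (e div q ^ j mod q))"
      unfolding i_def by (simp add: sum.atLeast1_atMost_eq)
    also have "\<dots> = e"
      using e_less by (simp add: sum_digits_mult_power)
    finally show ?thesis .
  qed
  have all: "(\<Sum>j=1..n. q ^ (j - 1) * i j) + (\<Sum>j=1..n. q ^ (j - 1) * i' j) = q ^ n - 1"
  proof -
    have "(\<Sum>j=1..n. q ^ (j - 1) * i j) + (\<Sum>j=1..n. q ^ (j - 1) * i' j)
        = (\<Sum>j=1..n. q ^ (j - 1) * (q - 1))"
      unfolding sum.distrib[symmetric] distrib_left[symmetric] i'_def
      using i_less q by (intro sum.cong) (auto simp: less_Suc_eq_le[symmetric])
    also have "\<dots> = (q - 1) * (\<Sum>j<n. q ^ j)"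
      by (simp add: sum.atLeast1_atMost_eq sum_distrib_left mult.commute)
    also have "\<dots> = q ^ n - 1"
    proof -
      have "(q - 1) * (\<Sum>j<k. q ^ j) + 1 = q ^ k" for k
      proof (induction k)
        case (Suc k)
        have "(q - 1) * (\<Sum>j<Suc k. q ^ j) + 1 = q ^ k + (q - 1) * q ^ k"
          using Suc.IH by (simp add: distrib_left)
        also have "\<dots> = (1 + (q - 1)) * q ^ k"
          by (simp only: distrib_right mult_1)
        finally show ?case
          using q by simp
      qed simp
      from this[of n] show ?thesis
        by simp
    qed
    finally show ?thesis .
  qed
  then have wi': "(\<Sum>j=1..n. q ^ (j - 1) * i' j) = q ^ n - 1 - e"
    unfolding wi by simp
  \<comment> \<open>The weight of a nonconstant monomial of the algebra is a positive multiple of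
    \<open>q ^ h - 1\<close>. Its digit sum is therefore at least \<open>N\<close>, and the degree
    is at least the digit sum.\<close>
  have max: "alg_max q n e \<subseteq> alg_part q n e (high_exponents n N)"
    unfolding alg_max_def
  proof (rule alg_part_mono, rule subsetI)
    fix m assume m: "m \<in> graded_exponents q n e - {0}"
    have "N \<le> digit_sum q (weight q n m)"
      unfolding N_def
    proof (rule digit_sum_ge_of_power_minus_one_dvd[OF q h])
      show "(q ^ h - 1) dvd weight q n m"
        using m dvd_trans[OF dvd(1)] by (simp add: graded_exponents_def)
      show "0 < weight q n m"
        using m weight_pos[OF q0] by (simp add: graded_exponents_def)
    qed
    also have "\<dots> \<le> total_degree n m"
      unfolding weight_def total_degree_def by (rule digit_sum_weighted_sum_le[OF q]) simp
    finally show "m \<in> high_exponents n N"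
      using m by (simp add: high_exponents_def graded_exponents_def)
  qed
  have "ideal_prod (alg_A q n e) (alg_max q n e) (alg_max q n e)
      \<subseteq> alg_part q n e (high_exponents n (N + N))"
    by (rule ideal_prod_alg_part[OF high_exponents_subset high_exponents_subset high_exponents_subset
          max max]) (rule high_exponents_add)
  then have "ideal_prod (alg_A q n e) (ideal_prod (alg_A q n e) (alg_max q n e) (alg_max q n e)) (alg_max q n e)
      \<subseteq> alg_part q n e (high_exponents n (N + N + N))"
    by (rule ideal_prod_alg_part[OF high_exponents_subset high_exponents_subset high_exponents_subset
          _ max]) (rule high_exponents_add)
  \<comment> \<open>Here \<open>3 * N > 2 * N = n * (q - 1)\<close>, strictly because
    \<open>N > 0\<close>.\<close>
  also have "\<dots> \<subseteq> alg_part q n e (large_exponents q n)"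
    using q h by (intro alg_part_mono high_exponents_subset_large) (simp add: N_def n)
  finally have "ideal_prod (alg_A q n e) (ideal_prod (alg_A q n e) (alg_max q n e) (alg_max q n e)) (alg_max q n e)
      \<subseteq> {\<zero>\<^bsub>alg_A q n e\<^esub> :: 'f mpoly set}"
    unfolding alg_A_ops by (blast dest: alg_part_large)
  moreover have ideal: "ideal (ideal_prod (alg_A q n e) (ideal_prod (alg_A q n e) (alg_max q n e) (alg_max q n e))
      (alg_max q n e)) (alg_A q n e :: 'f mpoly set ring)"
    by (intro A.ideal_prod_is_ideal ideal_alg_max q0)
  ultimately have cube: "ideal_prod (alg_A q n e)
      (ideal_prod (alg_A q n e) (alg_max q n e) (alg_max q n e)) (alg_max q n e)
      = {\<zero>\<^bsub>alg_A q n e\<^esub> :: 'f mpoly set}"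
    using additive_subgroup.zero_closed[OF ideal.axioms(1)[OF ideal]] by blast
  show ?thesis
  proof (rule A.loewy_length_eq_3I[OF ideal_alg_max[OF q0] jacobson_radical_alg_A[OF q0] cube])
    show "trunc_monom q n i \<in> (alg_max q n e :: 'f mpoly set set)"
      using e(1) by (intro trunc_monom_in_alg_max) (simp_all only: wi dvd_refl)
    show "trunc_monom q n i' \<in> (alg_max q n e :: 'f mpoly set set)"
      \<comment> \<open>The weight \<open>q ^ n - 1 - e\<close> is again a multiple of
        \<open>e\<close>, and it is positive because \<open>e\<close> is a proper divisor.\<close>
      unfolding alg_A_ops using e_less dvd(2)
      by (intro trunc_monom_in_alg_max) (auto simp only: wi' dvd_diff_nat dvd_refl zero_less_diff)
    show "trunc_monom q n i \<otimes>\<^bsub>alg_A q n e\<^esub> trunc_monom q n i' \<noteq> (\<zero>\<^bsub>alg_A q n e\<^esub> :: 'f mpoly set)"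
      unfolding alg_A_ops
    proof (rule trunc_monom_mult_nonzero)
      show "i j + i' j < q" for j
        using i_less[of j] by (simp add: i'_def)
    qed
  qed
qed

section \<open>Digit sums of the multiples of \<open>e\<close>, and the resulting values of m(q,e)
  and the Loewy length\<close>

theorem lemma5p8:
  fixes q n e z :: nat
  assumes "q > 1" and "n > 0" and "even n"
    and "e > 0" and "e dvd q ^ n - 1" and "e \<noteq> q ^ n - 1"
    and "(q ^ (n div 2) - 1) dvd e"
    and "z = (q ^ n - 1) div e"
  shows "(\<forall>k\<in>{1..z - 1}. real (digit_sum q (k * e)) = real n * ((real q - 1) / 2)) \<and>
         real (min_power_sum q e) = real n * ((real q - 1) / 2) \<and>
         loewy_length (alg_A q n e :: ((nat \<Rightarrow>\<^sub>0 nat) \<Rightarrow>\<^sub>0 'f::field) set ring) = 3 \<and>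
         (3::real) = real n * ((real q - 1) / real (min_power_sum q e)) + 1"
proof -
  define h where "h = n div 2"
  have n: "n = 2 * h" and h: "h > 0"
    using assms(2,3) by (auto simp: h_def)
  have dvd: "(q ^ h - 1) dvd e"
    using assms(7) by (simp add: h_def)
  have qh: "q ^ h > 1"
    using assms(1) h by (rule one_less_power)
  \<comment> \<open>After division by \<open>q ^ h - 1\<close>, a multiple
    \<open>k * e < q ^ n - 1\<close> leaves a cofactor \<open>b\<close> with
    \<open>1 \<le> b \<le> q ^ h\<close>, exactly the range in which the two-block expansion
    applies.\<close>
  have factor: "q ^ n - 1 = (q ^ h - 1) * (q ^ h + 1)"
    unfolding n mult_2 power_add by (simp add: algebra_simps)
  have z: "q ^ n - 1 = z * e"
    using assms(5,8) by simp
  have digits: "digit_sum q (k * e) = h * (q - 1)" if k: "k \<in> {1..z - 1}" for k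
  proof -
    obtain b where b: "k * e = (q ^ h - 1) * b"
      using dvd by (metis dvd_def dvd_mult)
    have "k < z"
      using k by auto
    then have "k * e < z * e"
      using assms(4) by simp
    then have "(q ^ h - 1) * b < (q ^ h - 1) * (q ^ h + 1)"
      unfolding b z[symmetric] factor .
    then have "b < q ^ h + 1"
      by (simp only: mult_less_cancel1)
    then have "b \<le> q ^ h"
      by simp
    moreover have "0 < k * e"
      using k assms(4) by simp
    then have "0 < b"
      using b by (metis mult_0_right neq0_conv)
    ultimately show ?thesis
      using digit_sum_mult_power_minus_one[OF assms(1)] b by simp
  qed
  have "q ^ n - 1 > 0"
    unfolding factor using qh by simp
  \<comment> \<open>Since \<open>e\<close> is a proper divisor, \<open>k = 1\<close> is an
    admissible index, which gives the digit sum of \<open>e\<close> itself.\<close>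
  then have "z \<noteq> 0" "z \<noteq> 1"
    using z assms(6) by (auto intro!: Nat.gr0I)
  then have m: "min_power_sum q e = h * (q - 1)"
    using digits[of 1] by (intro min_power_sum_eq[OF assms(1) h dvd]) simp
  have real: "real (h * (q - 1)) = real n * ((real q - 1) / 2)"
    using assms(1) by (simp add: n of_nat_diff)
  have "loewy_length (alg_A q n e :: 'f mpoly set ring) = 3"
    using assms(1) h n dvd assms(5,4,6) by (rule loewy_length_alg_A)
  \<comment> \<open>With m(q,e) equal to \<open>n * (q - 1) / 2\<close> the quotient is 2;
    \<open>n > 0\<close> and \<open>q > 1\<close> keep the denominator nonzero.\<close>
  moreover have "(3::real) = real n * ((real q - 1) / real (min_power_sum q e)) + 1"
    unfolding m real using assms(1,2) by (simp add: field_simps)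
  ultimately show ?thesis
    using digits m real by simp
qed

end
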